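(* Let $\mathcal M=\{(1,0),(0,1),(1,1)\}$, and let $V(\mathcal M)$ be the $6$-dimensional space of functions on the torus $\mathbb T^2=\mathbb R^2/(2\pi\mathbb Z)^2$ of the form $$p\cos x+q\sin x+r\cos y+s\sin y+t\cos(x+y)+u\sin(x+y),\qquad p,q,r,s,t,u\in\mathbb R .$$ Then the expected number of critical points of a random function in $V(\mathcal M)$ is $$\mu(\mathcal M)=\frac{4\pi}{3}.$$
   Context: $V(\mathcal M)$ is equipped with the $L^2(\mathbb T^2)$ inner product for the flat metric, and $\mu(\mathcal M)=\frac1{\mathrm{area}(S)}\int_S\mu(v)\,|dS(v)|$, where $S$ is the unit sphere of $V(\mathcal M)$ and $\mu(v)$ is the number of critical points of $v:\mathbb T^2\to\mathbb R$. *)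

theory Defs
  imports "HOL-Analysis.Analysis" "HOL-Analysis.Embed_Measure" "HOL-Library.Numeral_Type"
begin

definition torus_eq :: "real \<times> real \<Rightarrow> real \<times> real \<Rightarrow> bool" where
  "torus_eq z w \<longleftrightarrow>
     (\<exists>j k :: int. w = (fst z + 2 * pi * of_int j, snd z + 2 * pi * of_int k))"

lemma equivp_torus_eq: "equivp torus_eq"
proof (rule equivpI)
  show "reflp torus_eq"
  proof (rule reflpI)
    fix z show "torus_eq z z"
      unfolding torus_eq_def by (rule exI[of _ 0], rule exI[of _ 0]) simp
  qed
  show "symp torus_eq"
  proof (rule sympI)
    fix z w assume "torus_eq z w"
    then obtain j k :: int
      where w: "w = (fst z + 2 * pi * of_int j, snd z + 2 * pi * of_int k)"
      unfolding torus_eq_def by blast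
    show "torus_eq w z"
      unfolding torus_eq_def w
      by (rule exI[of _ "- j"], rule exI[of _ "- k"]) simp
  qed
  show "transp torus_eq"
  proof (rule transpI)
    fix z w y assume "torus_eq z w" "torus_eq w y"
    then obtain j k j' k' :: int
      where w: "w = (fst z + 2 * pi * of_int j, snd z + 2 * pi * of_int k)"
        and y: "y = (fst w + 2 * pi * of_int j', snd w + 2 * pi * of_int k')"
      unfolding torus_eq_def by blast
    show "torus_eq z y"
      unfolding torus_eq_def y w
      by (rule exI[of _ "j + j'"], rule exI[of _ "k + k'"]) (simp add: algebra_simps)
  qed
qed

quotient_type torus = "real \<times> real" / torus_eq
  morphisms rep_torus torus_of
  by (rule equivp_torus_eq)

text \<open>
  The projection \<^term>\<open>torus_of\<close> is a local diffeomorphism, so the differential of \<open>v\<close>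
  vanishes at \<open>torus_of z\<close> iff that of \<open>v \<circ> torus_of\<close> vanishes at \<open>z\<close>.
\<close>

definition critical_points :: "(torus \<Rightarrow> real) \<Rightarrow> torus set" where
  "critical_points v = {torus_of z | z. ((v \<circ> torus_of) has_derivative (\<lambda>_. 0)) (at z)}"

text \<open>Counting measure takes the value \<open>\<infinity>\<close> on infinite sets, unlike \<^const>\<open>card\<close>.\<close>

definition num_critical_points :: "(torus \<Rightarrow> real) \<Rightarrow> ennreal" where
  "num_critical_points v = emeasure (count_space UNIV) (critical_points v)"

text \<open>The flat area measure of the torus is realised on a fundamental domain.\<close>

definition L2_inner :: "(torus \<Rightarrow> real) \<Rightarrow> (torus \<Rightarrow> real) \<Rightarrow> real" where
  "L2_inner u v =
     (LINT z : {0..<2 * pi} \<times> {0..<2 * pi} | lborel. u (torus_of z) * v (torus_of z))"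

text \<open>Intended for finite \<open>M\<close> only.\<close>

definition trig_space :: "(int \<times> int) set \<Rightarrow> (torus \<Rightarrow> real) set" where
  "trig_space M = {v. \<exists>a b :: int \<times> int \<Rightarrow> real. \<forall>x y. v (torus_of (x, y)) =
     (\<Sum>(m, n)\<in>M. a (m, n) * cos (of_int m * x + of_int n * y)
                + b (m, n) * sin (of_int m * x + of_int n * y))}"

lemma trig_space_triangle:
  "trig_space {(1, 0), (0, 1), (1, 1)} = {v. \<exists>p q r s t u. \<forall>x y. v (torus_of (x, y)) =
     p * cos x + q * sin x + r * cos y + s * sin y + t * cos (x + y) + u * sin (x + y)}"
  (is "?L = ?R")
proof
  show "?L \<subseteq> ?R"
  proof
    fix v assume "v \<in> ?L"
    then obtain a b :: "int \<times> int \<Rightarrow> real" where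
      "\<forall>x y. v (torus_of (x, y)) =
         a (1, 0) * cos x + b (1, 0) * sin x + a (0, 1) * cos y + b (0, 1) * sin y
         + a (1, 1) * cos (x + y) + b (1, 1) * sin (x + y)"
      by (auto simp: trig_space_def add.assoc)
    then show "v \<in> ?R" by blast
  qed
  show "?R \<subseteq> ?L"
  proof
    fix v assume "v \<in> ?R"
    then obtain p q r s t u where v: "\<And>x y. v (torus_of (x, y)) =
      p * cos x + q * sin x + r * cos y + s * sin y + t * cos (x + y) + u * sin (x + y)"
      by auto
    define a b :: "int \<times> int \<Rightarrow> real"
      where "a = (\<lambda>_. 0)((1, 0) := p, (0, 1) := r, (1, 1) := t)"
        and "b = (\<lambda>_. 0)((1, 0) := q, (0, 1) := s, (1, 1) := u)"
    show "v \<in> ?L"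
      unfolding trig_space_def mem_Collect_eq
      by (rule exI[of _ a], rule exI[of _ b]) (simp add: v a_def b_def)
  qed
qed

text \<open>
  The surface measure of the unit sphere of a Euclidean space of dimension \<open>n\<close>, normalised as
  usual: \<open>\<sigma>(A)\<close> is \<open>n\<close> times the volume of the cone \<open>{t x | x \<in> A, 0 < t < 1}\<close>.
\<close>

definition sphere_measure :: "'a::euclidean_space measure" where
  "sphere_measure = scale_measure (of_nat DIM('a))
     (distr (restrict_space lborel (ball 0 1 - {0})) (restrict_space borel (sphere 0 1))
        (\<lambda>x. x /\<^sub>R norm x))"

definition lin_comb :: "('n::finite \<Rightarrow> torus \<Rightarrow> real) \<Rightarrow> real ^ 'n \<Rightarrow> torus \<Rightarrow> real" where
  "lin_comb e c = (\<lambda>\<theta>. \<Sum>i\<in>UNIV. c $ i * e i \<theta>)"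

definition L2_orthonormal_basis ::
    "(torus \<Rightarrow> real) set \<Rightarrow> ('n::finite \<Rightarrow> torus \<Rightarrow> real) \<Rightarrow> bool" where
  "L2_orthonormal_basis V e \<longleftrightarrow>
     range (lin_comb e) = V \<and> (\<forall>i j. L2_inner (e i) (e j) = (if i = j then 1 else 0))"

definition unit_sphere :: "(torus \<Rightarrow> real) set \<Rightarrow> (torus \<Rightarrow> real) set" where
  "unit_sphere V = {v \<in> V. L2_inner v v = 1}"

text \<open>
  In the following, \<open>V\<close> is a space of functions whose dimension is the cardinality of the type
  \<open>'n\<close>. The surface measure of the unit sphere of \<open>V\<close> is transported from the one of
  \<^typ>\<open>real ^ 'n\<close> along the linear isometry given by an orthonormal basis of \<open>V\<close>; as
  \<^const>\<open>sphere_measure\<close> is invariant under orthogonal maps, the choice of basis is irrelevant.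
\<close>

definition unit_sphere_measure ::
    "'n::finite itself \<Rightarrow> (torus \<Rightarrow> real) set \<Rightarrow> (torus \<Rightarrow> real) measure" where
  "unit_sphere_measure _ V =
     embed_measure sphere_measure
       (lin_comb (SOME e :: 'n \<Rightarrow> torus \<Rightarrow> real. L2_orthonormal_basis V e))"

definition mean_critical_points :: "'n::finite itself \<Rightarrow> (torus \<Rightarrow> real) set \<Rightarrow> ennreal" where
  "mean_critical_points d V =
     (\<integral>\<^sup>+v\<in>unit_sphere V. num_critical_points v \<partial>unit_sphere_measure d V)
       / emeasure (unit_sphere_measure d V) (unit_sphere V)"

end

theory Submission
  imports Defs "HOL-Probability.Distributions" "HOL-Real_Asymp.Real_Asymp"
begin

text \<open>
  The number of critical points does not change when a function is multiplied by a nonzero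
  constant, so its average over the unit sphere equals its average for the Gaussian density
  \<open>exp (- |c|\<^sup>2 / 2)\<close> on the six coefficients \<open>c = (p, q, r, s, t, u)\<close>. The six waves have equal
  \<open>L\<^sup>2\<close> norm and are orthogonal, hence every orthonormal basis arises from them by an orthogonal map
  and a common factor, and the Gaussian average does not notice either
  (\<open>mean_critical_points_eq_gaussian\<close>).

  The Gaussian average is computed in the manner of Kac and Rice. Put
  \<open>k = t sin (x + y) - u cos (x + y)\<close>. A point \<open>(x, y)\<close> with \<open>cos x\<close> and \<open>cos y\<close> nonzero is critical
  iff \<open>q = (p sin x + k) / cos x\<close> and \<open>s = (r sin y + k) / cos y\<close>. For fixed \<open>t, u, p, r\<close> the critical
  points are therefore the preimages of \<open>(q, s)\<close> under an explicit map of the plane, and the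
  area formula (\<open>area_formula\<close>) replaces the integral over \<open>(q, s)\<close> by an integral over the points
  \<open>(x, y)\<close>, weighted with the Jacobian of that map. The remaining points, on finitely many
  coordinate lines, are critical only for a null set of coefficients
  (\<open>negligible_critical_on_line\<close>).

  After exchanging the integrals, one integrates at each point over the functions that are critical
  there. In the rotated coordinates \<open>a = p cos x + q sin x\<close>, \<open>b = r cos y + s sin y\<close>,
  \<open>\<tau> = t cos (x + y) + u sin (x + y)\<close> the second derivatives of such a function are \<open>v\<^sub>x\<^sub>x = - (a + \<tau>)\<close>,
  \<open>v\<^sub>y\<^sub>y = - (b + \<tau>)\<close>, \<open>v\<^sub>x\<^sub>y = - \<tau>\<close>, so its Hessian determinant is \<open>a b + a \<tau> + b \<tau>\<close>; and \<open>|c|\<^sup>2\<close> becomes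
  \<open>a\<^sup>2 + b\<^sup>2 + \<tau>\<^sup>2 + 3 k\<^sup>2\<close>, because all three frequency pairs have the same component \<open>k\<close>. The
  result does not depend on the point (\<open>nn_integral_kac_rice_density\<close>). The quadratic form has
  eigenvalues \<open>1, - 1/2, - 1/2\<close>, so rotations bring it to \<open>X\<^sup>2 - (Y\<^sup>2 + Z\<^sup>2) / 2\<close>, and polar coordinates
  in \<open>(Y, Z)\<close> give \<open>4 \<pi> sqrt (2 \<pi> / 3)\<close>; with the factor \<open>sqrt (2 \<pi> / 3)\<close> from \<open>k\<close> every point
  contributes \<open>8 \<pi>\<^sup>2 / 3\<close>. Multiplying by the area \<open>4 \<pi>\<^sup>2\<close> and dividing by the total Gaussian mass
  \<open>(2 \<pi>)\<^sup>3\<close> yields \<open>4 \<pi> / 3\<close>.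
\<close>

section \<open>The area formula for maps with multiplicity\<close>

text \<open>
  The inverse function theorem in matrix form: continuity of the matrix entries bounds the operator
  norm of \<open>J x - J a\<close> near \<open>a\<close>.
\<close>

lemma locally_injective_if_det_nonzero:
  fixes F :: "real^'n \<Rightarrow> real^'n" and J :: "real^'n \<Rightarrow> real^'n^'n"
  assumes D: "open D" and der: "\<And>x. x \<in> D \<Longrightarrow> (F has_derivative (*v) (J x)) (at x)"
    and cont: "continuous_on D J" and a: "a \<in> D" and det: "det (J a) \<noteq> 0"
  obtains r where "r > 0" "ball a r \<subseteq> D" "inj_on F (ball a r)"
proof -
  from det obtain B where B: "B ** J a = mat 1"
    using invertible_det_nz unfolding invertible_def by blast
  have "\<exists>d>0. \<forall>x. dist a x < d \<longrightarrow> onorm (\<lambda>v. J x *v v - J a *v v) < e" if "e > 0" for e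
  proof -
    let ?s = "\<lambda>x. \<Sum>i\<in>UNIV. \<Sum>j\<in>UNIV. \<bar>(J x - J a) $ i $ j\<bar>"
    have "isCont J a" using cont D a continuous_on_eq_continuous_at by blast
    then have "isCont ?s a" by (intro continuous_intros) auto
    then have "(?s \<longlongrightarrow> 0) (at a)" by (simp add: isCont_def)
    then have "\<forall>\<^sub>F x in at a. ?s x < e" using \<open>e > 0\<close> by (rule order_tendstoD)
    then obtain d where d: "d > 0" "\<And>x. x \<noteq> a \<Longrightarrow> dist x a < d \<Longrightarrow> ?s x < e"
      unfolding eventually_at by auto
    have "onorm (\<lambda>v. J x *v v - J a *v v) < e" if "dist a x < d" for x
    proof -
      have "onorm (\<lambda>v. J x *v v - J a *v v) = onorm ((*v) (J x - J a))"
        by (intro arg_cong[where f = onorm] ext) (simp add: matrix_vector_mult_diff_rdistrib)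
      also have "\<dots> \<le> ?s x" by (rule onorm_le_matrix_component_sum)
      also have "\<dots> < e" using d that \<open>e > 0\<close> by (cases "x = a") (auto simp: dist_commute)
      finally show ?thesis .
    qed
    with d(1) show ?thesis by blast
  qed
  then show ?thesis
    using has_derivative_locally_injective[OF a D matrix_vector_mul_bounded_linear[of B], of "\<lambda>x. (*v) (J x)" F]
      der B that by (auto simp: fun_eq_iff matrix_vector_mul_assoc)
qed

text \<open>
  The change of variables theorem for vector-valued functions, applied to \<open>g\<close> as a function into
  \<open>real^1\<close>. Integrability of \<open>g\<close> over the whole space makes it integrable over any measurable image.
\<close>

lemma nn_integral_image_injective:
  fixes F :: "real^'n::{finite,wellorder} \<Rightarrow> real^'n::_" and J :: "real^'n::_ \<Rightarrow> real^'n::_^'n::_"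
    and g :: "real^'n::_ \<Rightarrow> real"
  assumes S: "S \<in> sets lebesgue"
    and der: "\<And>x. x \<in> S \<Longrightarrow> (F has_derivative (*v) (J x)) (at x)"
    and inj: "inj_on F S" and g: "integrable lborel g" "\<And>y. g y \<ge> 0"
  shows "(\<integral>\<^sup>+y. ennreal (g y) * indicator (F ` S) y \<partial>lborel)
       = (\<integral>\<^sup>+x. ennreal (\<bar>det (J x)\<bar> * g (F x)) * indicator S x \<partial>lborel)"
proof -
  have FS: "F ` S \<in> sets lebesgue"
    using der differentiable_at_withinI differentiable_def
    by (intro differentiable_image_in_sets_lebesgue S) (auto simp: differentiable_on_def, blast)
  have gi: "integrable lebesgue g" using g integrable_completion by blast
  let ?f = "\<lambda>y. g y *\<^sub>R (1 :: real^1)"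
  have f_int: "?f absolutely_integrable_on F ` S"
    using set_integrable_subset[of lebesgue UNIV ?f "F ` S"] gi FS
    by (auto simp: set_integrable_def)
  have *: "(\<lambda>x. \<bar>det (matrix ((*v) (J x)))\<bar> *\<^sub>R ?f (F x)) absolutely_integrable_on S \<and>
           integral S (\<lambda>x. \<bar>det (matrix ((*v) (J x)))\<bar> *\<^sub>R ?f (F x)) = integral (F ` S) ?f"
    using has_absolute_integral_change_of_variables[OF S has_derivative_at_withinI[OF der] inj,
        where f = ?f and b = "integral (F ` S) ?f"] f_int by blast
  let ?h = "\<lambda>x. \<bar>det (J x)\<bar> * g (F x)"
  have h_int: "?h absolutely_integrable_on S"
    using absolutely_integrable_component[OF conjunct1[OF *], of "axis 1 1"]
    by (simp add: inner_axis mult.assoc)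
  have g_int: "g absolutely_integrable_on F ` S"
    using absolutely_integrable_component[OF f_int, of "axis 1 1"] by (simp add: inner_axis)
  have eq: "integral S ?h = integral (F ` S) g"
  proof -
    have "integral S ?h = integral S (\<lambda>x. (\<bar>det (J x)\<bar> *\<^sub>R ?f (F x)) $ 1)" by simp
    also have "\<dots> = integral S (\<lambda>x. \<bar>det (J x)\<bar> *\<^sub>R ?f (F x)) $ 1"
      using * by (intro integral_component_eq_cart) (auto intro: set_lebesgue_integral_eq_integral(1))
    also have "\<dots> = integral (F ` S) ?f $ 1" using * by simp
    also have "\<dots> = integral (F ` S) (\<lambda>y. ?f y $ 1)"
      by (intro integral_component_eq_cart[symmetric] set_lebesgue_integral_eq_integral(1) f_int)
    finally show ?thesis by simp
  qed
  have "(\<integral>\<^sup>+y. ennreal (g y) * indicator (F ` S) y \<partial>lborel) = integral (F ` S) g"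
    using g(2) g_int by (intro nn_integral_has_integral_lebesgue')
      (auto intro: set_lebesgue_integral_eq_integral(1))
  moreover have "(\<integral>\<^sup>+x. ennreal (?h x) * indicator S x \<partial>lborel) = integral S ?h"
    using g(2) h_int by (intro nn_integral_has_integral_lebesgue')
      (auto intro: set_lebesgue_integral_eq_integral(1))
  ultimately show ?thesis using eq by simp
qed

text \<open>
  Lindeloef's property selects countably many of the balls on which \<open>F\<close> is injective; making them
  disjoint preserves injectivity.
\<close>

lemma open_countable_injective_cover:
  fixes F :: "real^'n \<Rightarrow> real^'n" and J :: "real^'n \<Rightarrow> real^'n^'n"
  assumes D: "open D" and der: "\<And>x. x \<in> D \<Longrightarrow> (F has_derivative (*v) (J x)) (at x)"
    and cont: "continuous_on D J" and det: "\<And>x. x \<in> D \<Longrightarrow> det (J x) \<noteq> 0"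
  obtains A :: "nat \<Rightarrow> (real^'n) set"
  where "disjoint_family A" "(\<Union>n. A n) = D" "\<And>n. A n \<in> sets borel" "\<And>n. inj_on F (A n)"
proof -
  let ?\<F> = "{U. open U \<and> U \<subseteq> D \<and> inj_on F U}"
  have "D \<subseteq> \<Union>?\<F>"
  proof
    fix a assume "a \<in> D"
    then obtain r where "r > 0" "ball a r \<subseteq> D" "inj_on F (ball a r)"
      using locally_injective_if_det_nonzero[OF D der cont _ det] by blast
    then show "a \<in> \<Union>?\<F>" by (intro UnionI[of "ball a r"]) auto
  qed
  then have UF: "\<Union>?\<F> = D" by blast
  obtain \<F>' where \<F>': "\<F>' \<subseteq> ?\<F>" "countable \<F>'" "\<Union>\<F>' = \<Union>?\<F>"
    using Lindelof[of ?\<F>] by auto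
  define U where "U = from_nat_into (insert {} \<F>')"
  have U: "range U = insert {} \<F>'"
    unfolding U_def using \<F>'(2) by (intro range_from_nat_into) auto
  have U': "U n \<in> insert {} ?\<F>" for n using U \<F>'(1) by blast
  show ?thesis
  proof
    show "disjoint_family (disjointed U)" by (rule disjoint_family_disjointed)
    show "(\<Union>n. disjointed U n) = D"
      unfolding UN_disjointed_eq U using trans[OF \<F>'(3) UF] by simp
    show "disjointed U n \<in> sets borel" for n
    proof -
      have "U m \<in> sets borel" for m using U'[of m] by auto
      then have "range U \<subseteq> sets borel" by blast
      then have "range (disjointed U) \<subseteq> sets borel" by (rule sets.range_disjointed_sets)
      then show ?thesis by blast
    qed
    show "inj_on F (disjointed U n)" for n
    proof (rule inj_on_subset[OF _ disjointed_subset])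
      show "inj_on F (U n)" using U'[of n] by auto
    qed
  qed
qed

text \<open>
  Where the determinant is nonzero, the domain splits into countably many disjoint Borel pieces on
  which \<open>F\<close> is injective, and the number of preimages is the sum of the indicators of their images.
  The points with vanishing determinant contribute nothing to the right-hand side, and by Sard's
  theorem their image is a null set, so they do not matter on the left-hand side either.
\<close>

lemma area_formula:
  fixes F :: "real^'n::{finite,wellorder} \<Rightarrow> real^'n::_" and J :: "real^'n::_ \<Rightarrow> real^'n::_^'n::_"
    and g :: "real^'n::_ \<Rightarrow> real"
  assumes D: "open D" and der: "\<And>x. x \<in> D \<Longrightarrow> (F has_derivative (*v) (J x)) (at x)"
    and cont: "continuous_on D J"
    and g: "integrable lborel g" "\<And>y. g y \<ge> 0"
  shows "(\<integral>\<^sup>+y. emeasure (count_space UNIV) {x \<in> D. F x = y} * ennreal (g y) \<partial>lborel)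
       = (\<integral>\<^sup>+x. ennreal (\<bar>det (J x)\<bar> * g (F x)) * indicator D x \<partial>lborel)"
proof -
  have gm[measurable]: "g \<in> borel_measurable borel" using g(1) by auto
  define E where "E = {x \<in> D. det (J x) \<noteq> 0}"
  have cdet: "continuous_on D (\<lambda>x. det (J x))"
    unfolding det_def by (intro continuous_intros cont)
  have oE: "open E"
  proof -
    have "E = D \<inter> (\<lambda>x. det (J x)) -` (-{0})" by (auto simp: E_def)
    then show ?thesis using continuous_open_preimage[OF cdet D, of "-{0}"] by auto
  qed
  have ED: "E \<subseteq> D" by (auto simp: E_def)
  obtain A :: "nat \<Rightarrow> (real^'n::_) set" where A: "disjoint_family A" "(\<Union>n. A n) = E" "\<And>n. A n \<in> sets borel"
    "\<And>n. inj_on F (A n)"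
    using open_countable_injective_cover[OF oE, of F J] der cont ED continuous_on_subset
    unfolding E_def by (smt (verit, ccfv_threshold) mem_Collect_eq subset_eq)
  have derE: "(F has_derivative (*v) (J x)) (at x)" if "x \<in> A n" for x n
    using der that A(2) ED by blast
  have FA: "F ` A n \<in> sets lebesgue" for n
    using A(3)[of n] derE[of _ n]
    by (intro differentiable_image_in_sets_lebesgue)
       (auto simp: differentiable_on_def intro: sets_completionI_sets differentiable_at_withinI differentiableI)
  let ?h = "\<lambda>x. ennreal (\<bar>det (J x)\<bar> * g (F x))"
  have hm: "(\<lambda>x. ?h x * indicator (A n) x) \<in> borel_measurable lborel" for n
  proof -
    have cF: "continuous_on D F"
      using der D by (auto intro!: has_derivative_continuous continuous_at_imp_continuous_on)
    have [measurable]: "(\<lambda>x. if x \<in> D then F x else 0) \<in> borel_measurable borel"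
      "(\<lambda>x. if x \<in> D then det (J x) else 0) \<in> borel_measurable borel" "A n \<in> sets borel"
      using D cF cdet A(3) by (auto intro!: borel_measurable_continuous_on_if)
    have "(\<lambda>x. ennreal (\<bar>if x \<in> D then det (J x) else 0\<bar> * g (if x \<in> D then F x else 0))
        * indicator (A n) x) \<in> borel_measurable lborel" by measurable
    also have "(\<lambda>x. ennreal (\<bar>if x \<in> D then det (J x) else 0\<bar> * g (if x \<in> D then F x else 0))
        * indicator (A n) x) = (\<lambda>x. ?h x * indicator (A n) x)"
      using A(2) ED by (force simp: indicator_def fun_eq_iff)
    finally show ?thesis .
  qed
  have neg: "negligible (F ` (D - E))"
  proof (rule baby_Sard)
    fix x assume "x \<in> D - E"
    then have "det (J x) = 0" by (auto simp: E_def)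
    then show "rank (matrix ((*v) (J x))) < CARD('n)"
      by (metis det_eq_0_rank matrix_of_matrix_vector_mul)
    show "(F has_derivative (*v) (J x)) (at x within D - E)"
      using \<open>x \<in> D - E\<close> by (auto intro!: has_derivative_at_withinI[OF der])
  qed auto
  have "AE y in lebesgue. y \<notin> F ` (D - E)"
    using neg by (metis AE_not_in negligible_iff_null_sets)
  then have AEy: "AE y in lebesgue. emeasure (count_space UNIV) {x \<in> D. F x = y}
      = (\<Sum>n. indicator (F ` A n) y)"
  proof eventually_elim
    case (elim y)
    have ind: "emeasure (count_space UNIV) {x \<in> A n. F x = y} = indicator (F ` A n) y" for n
    proof (cases "y \<in> F ` A n")
      case True
      then obtain x where "x \<in> A n" "F x = y" by blast
      then have "{x \<in> A n. F x = y} = {x}" using A(4)[of n] by (auto dest: inj_onD)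
      with True show ?thesis by simp
    next
      case False
      then have "{x \<in> A n. F x = y} = {}" by blast
      then show ?thesis using False by (simp only: emeasure_empty) simp
    qed
    have "{x \<in> D. F x = y} = (\<Union>n. {x \<in> A n. F x = y})" using elim A(2) ED by blast
    then have "emeasure (count_space UNIV) {x \<in> D. F x = y}
             = (\<Sum>n. emeasure (count_space UNIV) {x \<in> A n. F x = y})"
      using A(1) by (subst suminf_emeasure) (auto simp: disjoint_family_on_def)
    also have "\<dots> = (\<Sum>n. indicator (F ` A n) y)" by (simp only: ind)
    finally show ?case .
  qed
  have "(\<integral>\<^sup>+y. emeasure (count_space UNIV) {x \<in> D. F x = y} * ennreal (g y) \<partial>lborel)
     = (\<integral>\<^sup>+y. emeasure (count_space UNIV) {x \<in> D. F x = y} * ennreal (g y) \<partial>lebesgue)"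
    by (simp add: nn_integral_completion)
  also have "\<dots> = (\<integral>\<^sup>+y. (\<Sum>n. ennreal (g y) * indicator (F ` A n) y) \<partial>lebesgue)"
    using AEy by (intro nn_integral_cong_AE) (auto simp: mult.commute)
  also have "\<dots> = (\<Sum>n. (\<integral>\<^sup>+y. ennreal (g y) * indicator (F ` A n) y \<partial>lebesgue))"
  proof (rule nn_integral_suminf)
    fix n
    have "(\<lambda>y. ennreal (g y)) \<in> borel_measurable lebesgue"
      by (rule measurable_completion) measurable
    moreover have "(indicator (F ` A n) :: _ \<Rightarrow> ennreal) \<in> borel_measurable lebesgue"
      by (rule borel_measurable_indicator) (rule FA)
    ultimately show "(\<lambda>y. ennreal (g y) * indicator (F ` A n) y) \<in> borel_measurable lebesgue"
      by (rule borel_measurable_times_ennreal)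
  qed
  also have "\<dots> = (\<Sum>n. (\<integral>\<^sup>+x. ennreal (\<bar>det (J x)\<bar> * g (F x)) * indicator (A n) x \<partial>lebesgue))"
    unfolding nn_integral_completion
  proof (intro suminf_cong nn_integral_image_injective g A(4))
    fix n
    show "A n \<in> sets lebesgue" using A(3)[of n] by (simp add: sets_completionI_sets)
    show "\<And>x. x \<in> A n \<Longrightarrow> (F has_derivative (*v) (J x)) (at x)" by (rule derE)
  qed
  also have "\<dots> = (\<integral>\<^sup>+x. (\<Sum>n. ennreal (\<bar>det (J x)\<bar> * g (F x)) * indicator (A n) x) \<partial>lebesgue)"
    using hm by (intro nn_integral_suminf[symmetric]) (auto intro: measurable_completion)
  also have "\<dots> = (\<integral>\<^sup>+x. ennreal (\<bar>det (J x)\<bar> * g (F x)) * indicator D x \<partial>lebesgue)"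
  proof (intro nn_integral_cong)
    fix x
    show "(\<Sum>n. ennreal (\<bar>det (J x)\<bar> * g (F x)) * indicator (A n) x)
        = ennreal (\<bar>det (J x)\<bar> * g (F x)) * indicator D x"
    proof (cases "x \<in> E")
      case True
      then obtain m where m: "x \<in> A m" using A(2) by blast
      then have "x \<notin> A n" if "n \<noteq> m" for n
        using A(1) that by (auto simp: disjoint_family_on_def)
      then have "(\<Sum>n. ?h x * indicator (A n) x) = (\<Sum>n\<in>{m}. ?h x * indicator (A n) x)"
        by (intro suminf_finite) auto
      then show ?thesis using m True ED by auto
    next
      case False
      then have "x \<notin> A n" for n using A(2) by blast
      then show ?thesis using False by (auto simp: E_def indicator_def)
    qed
  qed
  finally show ?thesis by (simp add: nn_integral_completion)
qed

section \<open>Measurability of the number of zeros\<close>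

lemma emeasure_count_space_ge_card:
  assumes "finite Y" "Y \<subseteq> X"
  shows "of_nat (card Y) \<le> emeasure (count_space UNIV) X"
  using emeasure_mono[of Y X "count_space UNIV"] assms by simp

lemma ennreal_le_of_nat_bounds:
  fixes b :: ennreal
  assumes "\<And>n::nat. of_nat n \<le> b"
  shows "b = \<infinity>"
proof (rule ccontr)
  assume "b \<noteq> \<infinity>"
  then have "b < \<infinity>" by (simp add: top.not_eq_extremum)
  then obtain n where "b < of_nat n" using ennreal_Ex_less_of_nat by auto
  with assms[of n] show False by simp
qed

lemma emeasure_count_space_least:
  fixes b :: ennreal
  assumes "\<And>Y. finite Y \<Longrightarrow> Y \<subseteq> X \<Longrightarrow> of_nat (card Y) \<le> b"
  shows "emeasure (count_space UNIV) X \<le> b"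
proof (cases "finite X")
  case True
  then show ?thesis using assms[of X] by simp
next
  case False
  have "of_nat n \<le> b" for n
    using infinite_arbitrarily_large[OF False, of n] assms by blast
  then have "b = \<infinity>" by (rule ennreal_le_of_nat_bounds)
  then show ?thesis by simp
qed

text \<open>
  A ball of half the minimal distance around each point contains a basis set around it.
\<close>

lemma separate_finite_by_basis:
  fixes Y :: "'a::euclidean_space set"
  assumes "finite Y" and B: "topological_basis \<B>"
  obtains b where "\<And>y. y \<in> Y \<Longrightarrow> b y \<in> \<B> \<and> y \<in> b y" "disjoint_family_on b Y"
proof -
  obtain e where e: "e > 0" "\<And>x y. x \<in> Y \<Longrightarrow> y \<in> Y \<Longrightarrow> x \<noteq> y \<Longrightarrow> dist x y \<ge> e"
  proof -
    define d where "d = insert 1 ((\<lambda>(x, y). dist x y) ` {(x, y). (x, y) \<in> Y \<times> Y \<and> x \<noteq> y})"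
    have "finite {(x, y). (x, y) \<in> Y \<times> Y \<and> x \<noteq> y}"
      by (rule finite_subset[of _ "Y \<times> Y"]) (use assms(1) in auto)
    then have d: "finite d" "d \<noteq> {}" by (auto simp: d_def)
    have "Min d > 0" using d by (subst Min_gr_iff) (auto simp: d_def)
    moreover have "dist x y \<ge> Min d" if "x \<in> Y" "y \<in> Y" "x \<noteq> y" for x y
      using d that by (intro Min_le) (auto simp: d_def)
    ultimately show ?thesis using that by blast
  qed
  have "\<exists>b\<in>\<B>. y \<in> b \<and> b \<subseteq> ball y (e/2)" for y
    using topological_basisE[OF B, of "ball y (e/2)" y] e(1) by (metis centre_in_ball half_gt_zero open_ball)
  then obtain b where b: "\<And>y. b y \<in> \<B> \<and> y \<in> b y \<and> b y \<subseteq> ball y (e/2)" by metis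
  have "disjoint_family_on b Y"
  proof (unfold disjoint_family_on_def, intro ballI impI)
    fix x y assume xy: "x \<in> Y" "y \<in> Y" "x \<noteq> y"
    have "ball x (e/2) \<inter> ball y (e/2) = {}" using e(2)[OF xy] by (intro disjoint_ballI) auto
    then show "b x \<inter> b y = {}" using b[of x] b[of y] by blast
  qed
  with b show ?thesis using that by blast
qed

text \<open>
  The set is a countable union of closed sets: an open set is a countable union of compact sets, and
  the projection of a closed set along a compact factor is closed. Domains of the form
  \<open>C \<inter> U\<close> cover both open sets and half-open squares.
\<close>

lemma borel_zero_projection:
  fixes G :: "'z::euclidean_space \<Rightarrow> 'c::euclidean_space \<Rightarrow> 'd::real_normed_vector"
  assumes cont: "continuous_on UNIV (\<lambda>(z, c). G z c)" and "closed C" "open U"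
  shows "{c. \<exists>z. z \<in> C \<inter> U \<and> G z c = 0} \<in> sets borel"
proof -
  obtain K where K: "\<And>n::nat. compact (K n)" "\<And>n. K n \<subseteq> U" "(\<Union>n. K n) = U"
    using open_Union_compact_subsets[OF \<open>open U\<close>] by metis
  have T: "closed {p. (\<lambda>(z, c). G z c) p = 0}"
    using cont by (intro closed_Collect_eq) auto
  have "closed {c. \<exists>z. z \<in> C \<inter> K n \<and> (z, c) \<in> {p. (\<lambda>(z, c). G z c) p = 0}}" for n
    using K(1) \<open>closed C\<close> by (intro closed_compact_projection T) (simp add: closed_Int_compact)
  then have "(\<Union>n. {c. \<exists>z. z \<in> C \<inter> K n \<and> (z, c) \<in> {p. (\<lambda>(z, c). G z c) p = 0}}) \<in> sets borel"
    by (intro sets.countable_UN) auto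
  also have "(\<Union>n. {c. \<exists>z. z \<in> C \<inter> K n \<and> (z, c) \<in> {p. (\<lambda>(z, c). G z c) p = 0}})
    = {c. \<exists>z. z \<in> C \<inter> U \<and> G z c = 0}"
    using K(3) by auto
  finally show ?thesis .
qed

text \<open>
  There are at least \<open>n\<close> zeros iff some \<open>n\<close> disjoint members of a countable basis each contain one.
  Thus the number of zeros is the supremum, over the countably many finite disjoint families of basis
  sets, of the number of members that contain a zero.
\<close>

lemma borel_measurable_zero_count:
  fixes G :: "'z::euclidean_space \<Rightarrow> 'c::euclidean_space \<Rightarrow> 'd::real_normed_vector"
  assumes cont: "continuous_on UNIV (\<lambda>(z, c). G z c)" and C: "closed C" and U: "open U"
  shows "(\<lambda>c. emeasure (count_space UNIV) {z \<in> C \<inter> U. G z c = 0}) \<in> borel_measurable borel"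
proof -
  obtain \<B> :: "'z set set" where \<B>: "countable \<B>" "topological_basis \<B>"
    using ex_countable_basis by blast
  define P where "P B = {c. \<exists>z. z \<in> C \<inter> (U \<inter> B) \<and> G z c = 0}" for B
  have P[measurable]: "P B \<in> sets borel" if "B \<in> \<B>" for B
    unfolding P_def using that \<B>(2) by (intro borel_zero_projection cont C) (simp add: U open_Int topological_basis_open)
  define \<S> where "\<S> = {\<F>. finite \<F> \<and> \<F> \<subseteq> \<B> \<and> disjoint \<F>}"
  have cS: "countable \<S>"
    unfolding \<S>_def by (rule countable_subset[OF _ countable_Collect_finite_subset[OF \<B>(1)]]) auto
  have "emeasure (count_space UNIV) {z \<in> C \<inter> U. G z c = 0}
      = (SUP \<F>\<in>\<S>. \<Sum>B\<in>\<F>. indicator (P B) c)" for c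
  proof (rule antisym)
    let ?Z = "{z \<in> C \<inter> U. G z c = 0}"
    show "(SUP \<F>\<in>\<S>. \<Sum>B\<in>\<F>. indicator (P B) c) \<le> emeasure (count_space UNIV) ?Z"
    proof (rule SUP_least)
      fix \<F> assume \<F>: "\<F> \<in> \<S>"
      define \<F>' where "\<F>' = {B \<in> \<F>. c \<in> P B}"
      have "\<forall>B\<in>\<F>'. \<exists>z. z \<in> ?Z \<inter> B" by (auto simp: \<F>'_def P_def)
      then obtain z where z: "\<And>B. B \<in> \<F>' \<Longrightarrow> z B \<in> ?Z \<inter> B" by metis
      have "inj_on z \<F>'"
        using z \<F> unfolding \<F>'_def \<S>_def inj_on_def disjoint_def by (smt (verit) IntI Int_iff empty_iff mem_Collect_eq)
      then have "card \<F>' = card (z ` \<F>')" by (simp add: card_image)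
      have "(\<Sum>B\<in>\<F>. indicator (P B) c) = (of_nat (card \<F>') :: ennreal)"
        using \<F> by (simp add: \<F>'_def \<S>_def indicator_def sum.If_cases Int_def)
      also have "\<dots> = of_nat (card (z ` \<F>'))" using \<open>inj_on z \<F>'\<close> by (simp add: card_image)
      also have "\<dots> \<le> emeasure (count_space UNIV) ?Z"
        using z \<F> by (intro emeasure_count_space_ge_card) (auto simp: \<F>'_def \<S>_def)
      finally show "(\<Sum>B\<in>\<F>. indicator (P B) c) \<le> emeasure (count_space UNIV) ?Z" .
    qed
    show "emeasure (count_space UNIV) ?Z \<le> (SUP \<F>\<in>\<S>. \<Sum>B\<in>\<F>. indicator (P B) c)"
    proof (rule emeasure_count_space_least)
      fix Y assume Y: "finite Y" "Y \<subseteq> ?Z"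
      obtain b where b: "\<And>y. y \<in> Y \<Longrightarrow> b y \<in> \<B> \<and> y \<in> b y" "disjoint_family_on b Y"
        using separate_finite_by_basis[OF Y(1) \<B>(2)] by metis
      have inj: "inj_on b Y" using b unfolding inj_on_def disjoint_family_on_def by (metis IntI empty_iff)
      have bS: "b ` Y \<in> \<S>"
        using b Y unfolding \<S>_def disjoint_def disjoint_family_on_def by fastforce
      have "(\<Sum>B\<in>b ` Y. indicator (P B) c) = (\<Sum>B\<in>b ` Y. 1 :: ennreal)"
        using b(1) Y(2) by (intro sum.cong) (auto simp: P_def indicator_def)
      also have "\<dots> = of_nat (card Y)" using inj by (simp add: card_image)
      finally show "of_nat (card Y) \<le> (SUP \<F>\<in>\<S>. \<Sum>B\<in>\<F>. indicator (P B) c :: ennreal)"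
        using bS by (metis (no_types, lifting) SUP_upper)
    qed
  qed
  moreover have "(\<lambda>c. SUP \<F>\<in>\<S>. \<Sum>B\<in>\<F>. indicator (P B) c :: ennreal) \<in> borel_measurable borel"
    using P by (intro borel_measurable_SUP cS borel_measurable_sum borel_measurable_indicator) (auto simp: \<S>_def)
  ultimately show ?thesis by simp
qed

section \<open>Sphere averages and Gaussian averages\<close>

lemma ball_in_borel[measurable]: "ball a r \<in> sets borel"
  by simp

lemma nn_integral_ball_scale:
  fixes f :: "'a::euclidean_space \<Rightarrow> ennreal"
  assumes [measurable]: "f \<in> borel_measurable borel" and hom: "\<And>r x. r > 0 \<Longrightarrow> f (r *\<^sub>R x) = f x"
    and "\<rho> > 0"
  shows "(\<integral>\<^sup>+x. f x * indicator (ball 0 \<rho>) x \<partial>lborel)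
       = ennreal (\<rho> ^ DIM('a)) * (\<integral>\<^sup>+x. f x * indicator (ball 0 1) x \<partial>lborel)"
proof -
  have "(lborel :: 'a measure) = density (distr lborel borel (\<lambda>x. 0 + \<rho> *\<^sub>R x)) (\<lambda>_. ennreal (\<bar>\<rho>\<bar> ^ DIM('a)))"
    using \<open>\<rho> > 0\<close> by (intro lborel_affine) auto
  then have "(\<integral>\<^sup>+x. f x * indicator (ball 0 \<rho>) x \<partial>lborel)
     = (\<integral>\<^sup>+x. f x * indicator (ball 0 \<rho>) x \<partial>density (distr lborel borel (\<lambda>x. 0 + \<rho> *\<^sub>R x)) (\<lambda>_. ennreal (\<bar>\<rho>\<bar> ^ DIM('a))))"
    by simp
  also have "\<dots> = (\<integral>\<^sup>+x. ennreal (\<rho> ^ DIM('a)) * (f (\<rho> *\<^sub>R x) * indicator (ball 0 \<rho>) (\<rho> *\<^sub>R x)) \<partial>lborel)"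
    using \<open>\<rho> > 0\<close> by (simp add: nn_integral_density nn_integral_distr)
  also have "\<dots> = (\<integral>\<^sup>+x. ennreal (\<rho> ^ DIM('a)) * (f x * indicator (ball 0 1) x) \<partial>lborel)"
    using \<open>\<rho> > 0\<close> by (intro nn_integral_cong) (simp add: hom indicator_def)
  also have "\<dots> = ennreal (\<rho> ^ DIM('a)) * (\<integral>\<^sup>+x. f x * indicator (ball 0 1) x \<partial>lborel)"
    by (intro nn_integral_cmult) measurable
  finally show ?thesis .
qed

text \<open>
  This writes the Gaussian density as a mixture of indicators of balls.
\<close>

lemma gaussian_layer_cake:
  fixes s :: real
  assumes "s \<ge> 0"
  shows "(\<integral>\<^sup>+\<rho>. ennreal (\<rho> * exp (- \<rho>\<^sup>2 / 2)) * indicator {s..} \<rho> \<partial>lborel) = ennreal (exp (- s\<^sup>2 / 2))"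
proof -
  have "((\<lambda>\<rho>::real. - exp (- \<rho>\<^sup>2 / 2)) \<longlongrightarrow> 0) at_top" by real_asymp
  then have "(\<integral>\<^sup>+\<rho>. ennreal (\<rho> * exp (- \<rho>\<^sup>2 / 2)) * indicator {s..} \<rho> \<partial>lborel)
     = ennreal (0 - (- exp (- s\<^sup>2 / 2)))"
    using assms by (intro nn_integral_FTC_atLeast) (auto intro!: derivative_eq_intros)
  then show ?thesis by simp
qed

text \<open>
  Decompose the Gaussian density into indicators of balls of radius \<open>\<rho>\<close>. The integral of \<open>f\<close> over each
  of them is \<open>\<rho>\<^sup>n\<close> times the one over the unit ball, so the constant in front is the same for
  every \<open>f\<close>.
\<close>

lemma nn_integral_gaussian_homogeneous:
  fixes f :: "'a::euclidean_space \<Rightarrow> ennreal"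
  assumes [measurable]: "f \<in> borel_measurable borel" and hom: "\<And>r x. r > 0 \<Longrightarrow> f (r *\<^sub>R x) = f x"
  shows "(\<integral>\<^sup>+x. f x * ennreal (exp (- (norm x)\<^sup>2 / 2)) \<partial>lborel)
       = (\<integral>\<^sup>+\<rho>. ennreal (\<rho> * exp (- \<rho>\<^sup>2 / 2)) * ennreal (\<rho> ^ DIM('a)) * indicator {0<..} \<rho> \<partial>lborel)
         * (\<integral>\<^sup>+x. f x * indicator (ball 0 1) x \<partial>lborel)"
proof -
  let ?w = "\<lambda>\<rho>::real. ennreal (\<rho> * exp (- \<rho>\<^sup>2 / 2))"
  have "(\<integral>\<^sup>+x. f x * ennreal (exp (- (norm x)\<^sup>2 / 2)) \<partial>lborel)
     = (\<integral>\<^sup>+x. (\<integral>\<^sup>+\<rho>. f x * (?w \<rho> * indicator {norm x..} \<rho>) \<partial>lborel) \<partial>lborel)"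
  proof (intro nn_integral_cong)
    fix x :: 'a
    have "(\<integral>\<^sup>+\<rho>. f x * (?w \<rho> * indicator {norm x..} \<rho>) \<partial>lborel)
        = f x * (\<integral>\<^sup>+\<rho>. ?w \<rho> * indicator {norm x..} \<rho> \<partial>lborel)"
      by (intro nn_integral_cmult) measurable
    also have "\<dots> = f x * ennreal (exp (- (norm x)\<^sup>2 / 2))"
      by (subst gaussian_layer_cake) auto
    finally show "f x * ennreal (exp (- (norm x)\<^sup>2 / 2))
      = (\<integral>\<^sup>+\<rho>. f x * (?w \<rho> * indicator {norm x..} \<rho>) \<partial>lborel)" ..
  qed
  also have "\<dots> = (\<integral>\<^sup>+\<rho>. (\<integral>\<^sup>+x. f x * (?w \<rho> * indicator {norm x..} \<rho>) \<partial>lborel) \<partial>lborel)"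
    by (intro lborel_pair.Fubini') (simp add: indicator_def)
  also have "\<dots> = (\<integral>\<^sup>+\<rho>. ?w \<rho> * indicator {0<..} \<rho> * (\<integral>\<^sup>+x. f x * indicator (ball 0 \<rho>) x \<partial>lborel) \<partial>lborel)"
  proof (intro nn_integral_cong)
    fix \<rho> :: real
    show "(\<integral>\<^sup>+x. f x * (?w \<rho> * indicator {norm x..} \<rho>) \<partial>lborel)
       = ?w \<rho> * indicator {0<..} \<rho> * (\<integral>\<^sup>+x. f x * indicator (ball 0 \<rho>) x \<partial>lborel)"
    proof (cases "\<rho> > 0")
      case True
      have "AE x in lborel :: 'a measure. x \<notin> sphere 0 \<rho>"
        using negligible_sphere[of "0::'a" \<rho>] 
        by (metis AE_not_in negligible_iff_null_sets null_sets_completion_iff borel_closed closed_sphere sets_lborel)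
      then have "(\<integral>\<^sup>+x. f x * (?w \<rho> * indicator {norm x..} \<rho>) \<partial>lborel)
        = (\<integral>\<^sup>+x. ?w \<rho> * (f x * indicator (ball 0 \<rho>) x) \<partial>lborel)"
        by (intro nn_integral_cong_AE) (auto simp: indicator_def ac_simps)
      with True show ?thesis by (simp add: nn_integral_cmult)
    next
      case False
      then have "?w \<rho> = 0" by (simp add: ennreal_eq_0_iff mult_nonpos_nonneg)
      then show ?thesis by simp
    qed
  qed
  also have "\<dots> = (\<integral>\<^sup>+\<rho>. (?w \<rho> * ennreal (\<rho> ^ DIM('a)) * indicator {0<..} \<rho>) * (\<integral>\<^sup>+x. f x * indicator (ball 0 1) x \<partial>lborel) \<partial>lborel)"
  proof (intro nn_integral_cong)
    fix \<rho> :: real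
    show "?w \<rho> * indicator {0<..} \<rho> * (\<integral>\<^sup>+x. f x * indicator (ball 0 \<rho>) x \<partial>lborel)
      = ?w \<rho> * ennreal (\<rho> ^ DIM('a)) * indicator {0<..} \<rho> * (\<integral>\<^sup>+x. f x * indicator (ball 0 1) x \<partial>lborel)"
      using nn_integral_ball_scale[OF assms(1) hom, of \<rho>] by (cases "\<rho> > 0") (auto simp: mult.assoc)
  qed
  also have "\<dots> = (\<integral>\<^sup>+\<rho>. ?w \<rho> * ennreal (\<rho> ^ DIM('a)) * indicator {0<..} \<rho> \<partial>lborel)
         * (\<integral>\<^sup>+x. f x * indicator (ball 0 1) x \<partial>lborel)"
    by (rule nn_integral_multc) measurable
  finally show ?thesis .
qed

text \<open>
  The surface measure is defined through cones, and \<open>f\<close> is constant along rays.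
\<close>

lemma nn_integral_sphere_measure:
  fixes f :: "'a::euclidean_space \<Rightarrow> ennreal"
  assumes [measurable]: "f \<in> borel_measurable borel" and hom: "\<And>r x. r > 0 \<Longrightarrow> f (r *\<^sub>R x) = f x"
  shows "(\<integral>\<^sup>+x. f x \<partial>sphere_measure) = of_nat DIM('a) * (\<integral>\<^sup>+x. f x * indicator (ball 0 1) x \<partial>lborel)"
proof -
  let ?R = "restrict_space lborel (ball 0 1 - {0}) :: 'a measure"
  have m: "(\<lambda>x. x /\<^sub>R norm x) \<in> measurable ?R (restrict_space borel (sphere 0 1))"
    by (rule measurable_restrict_space2) (auto simp: space_restrict_space intro!: measurable_restrict_space1)
  have f: "f \<in> borel_measurable (restrict_space borel (sphere 0 1))"
    by (rule measurable_restrict_space1) fact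
  have "(\<integral>\<^sup>+x. f x \<partial>sphere_measure) = of_nat DIM('a) * (\<integral>\<^sup>+x. f (x /\<^sub>R norm x) \<partial>?R)"
    unfolding sphere_measure_def using f m by (simp add: nn_integral_scale_measure nn_integral_distr)
  also have "(\<integral>\<^sup>+x. f (x /\<^sub>R norm x) \<partial>?R) = (\<integral>\<^sup>+x. f (x /\<^sub>R norm x) * indicator (ball 0 1 - {0}) x \<partial>lborel)"
    by (subst nn_integral_restrict_space) auto
  also have "\<dots> = (\<integral>\<^sup>+x. f x * indicator (ball 0 1) x \<partial>lborel)"
  proof (rule nn_integral_cong_AE)
    show "AE x in lborel. f (x /\<^sub>R norm x) * indicator (ball 0 1 - {0}) x = f x * indicator (ball 0 1) x"
      using AE_lborel_singleton[of "0::'a"] by eventually_elim (auto simp: indicator_def hom)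
  qed
  finally show ?thesis .
qed

lemma nn_integral_gaussian_1:
  assumes "a > 0"
  shows "(\<integral>\<^sup>+x. ennreal (exp (- a * x\<^sup>2 / 2)) \<partial>lborel) = ennreal (sqrt (2 * pi / a))"
proof -
  define \<sigma> where "\<sigma> = 1 / sqrt a"
  have \<sigma>: "\<sigma> > 0" "\<sigma>\<^sup>2 = 1 / a" using assms by (auto simp: \<sigma>_def power_divide)
  have "has_bochner_integral lborel (normal_density 0 \<sigma>) 1"
    using normal_moment_even[OF \<sigma>(1), of 0 0] by simp
  then have "(\<integral>\<^sup>+x. ennreal (normal_density 0 \<sigma> x) \<partial>lborel) = ennreal 1"
    by (subst nn_integral_eq_integral) (auto simp: has_bochner_integral_iff)
  moreover have "exp (- a * x\<^sup>2 / 2) = sqrt (2 * pi / a) * normal_density 0 \<sigma> x" for x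
    using assms by (simp add: normal_density_def \<sigma>(2))
  ultimately show ?thesis
    using assms by (simp add: ennreal_mult' nn_integral_cmult)
qed

lemma nn_integral_gaussian_euclidean:
  "(\<integral>\<^sup>+x. ennreal (exp (- (norm (x :: 'a::euclidean_space))\<^sup>2 / 2)) \<partial>lborel) = ennreal (sqrt (2 * pi) ^ DIM('a))"
proof -
  have "(\<integral>\<^sup>+(x::'a). ennreal (exp (- (norm x)\<^sup>2 / 2)) \<partial>lborel)
      = (\<integral>\<^sup>+(x::'a). (\<Prod>b\<in>Basis. ennreal (exp (- 1 * (x \<bullet> b)\<^sup>2 / 2))) \<partial>lborel)"
  proof (intro nn_integral_cong)
    fix x :: 'a
    have "(norm x)\<^sup>2 = (\<Sum>b\<in>Basis. (x \<bullet> b)\<^sup>2)"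
      by (subst power2_norm_eq_inner, subst euclidean_inner) (simp add: power2_eq_square)
    then show "ennreal (exp (- (norm x)\<^sup>2 / 2)) = (\<Prod>b\<in>Basis. ennreal (exp (- 1 * (x \<bullet> b)\<^sup>2 / 2)))"
      by (simp add: prod_ennreal exp_sum[symmetric] sum_divide_distrib sum_negf)
  qed
  also have "\<dots> = (\<Prod>b\<in>(Basis :: 'a set). ennreal (sqrt (2 * pi)))"
    using nn_integral_gaussian_1[of 1] by (subst nn_integral_lborel_prod) simp_all
  also have "\<dots> = ennreal (sqrt (2 * pi) ^ DIM('a))" by (simp add: ennreal_power)
  finally show ?thesis .
qed

text \<open>
  Both averages are quotients of an integral of \<open>f\<close> by the integral of \<open>1\<close>, and both integrals are
  fixed multiples of the integral over the unit ball.
\<close>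

lemma sphere_mean_eq_gaussian_mean:
  fixes f :: "'a::euclidean_space \<Rightarrow> ennreal"
  assumes f: "f \<in> borel_measurable borel" and hom: "\<And>r x. r > 0 \<Longrightarrow> f (r *\<^sub>R x) = f x"
  shows "(\<integral>\<^sup>+x. f x \<partial>sphere_measure) / emeasure sphere_measure (sphere (0::'a) 1)
       = (\<integral>\<^sup>+x. f x * ennreal (exp (- (norm x)\<^sup>2 / 2)) \<partial>lborel) / ennreal (sqrt (2 * pi) ^ DIM('a))"
proof -
  define \<kappa> where "\<kappa> = (\<integral>\<^sup>+\<rho>. ennreal (\<rho> * exp (- \<rho>\<^sup>2 / 2)) * ennreal (\<rho> ^ DIM('a)) * indicator {0<..} \<rho> \<partial>lborel)"
  define I where "I = (\<integral>\<^sup>+x. f x * indicator (ball 0 1) x \<partial>lborel)"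
  define v where "v = emeasure lborel (ball (0::'a) 1)"
  have v: "v \<noteq> 0" "v \<noteq> \<infinity>"
  proof -
    have "unit_ball_vol (real DIM('a)) \<noteq> 0" by (metis less_irrefl of_nat_0_le_iff unit_ball_vol_pos)
    then show "v \<noteq> 0" "v \<noteq> \<infinity>" by (simp_all add: v_def emeasure_ball)
  qed
  have sp: "space (sphere_measure :: 'a measure) = sphere 0 1"
    by (simp add: sphere_measure_def space_restrict_space space_scale_measure)
  have "emeasure sphere_measure (sphere (0::'a) 1) = (\<integral>\<^sup>+x. 1 \<partial>(sphere_measure :: 'a measure))"
    using sp by simp
  also have "\<dots> = of_nat DIM('a) * v"
    by (subst nn_integral_sphere_measure) (auto simp: v_def)
  finally have S: "emeasure sphere_measure (sphere (0::'a) 1) = of_nat DIM('a) * v" .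
  have g1: "ennreal (sqrt (2 * pi) ^ DIM('a)) = \<kappa> * v"
    using nn_integral_gaussian_homogeneous[of "\<lambda>_::'a. 1"] nn_integral_gaussian_euclidean[where 'a = 'a]
    by (simp add: \<kappa>_def v_def)
  have \<kappa>: "\<kappa> \<noteq> 0" "\<kappa> \<noteq> \<infinity>"
  proof -
    show "\<kappa> \<noteq> 0" using g1 by (metis ennreal_eq_0_iff mult_zero_left not_le pi_gt_zero real_sqrt_gt_0_iff zero_less_mult_iff zero_less_numeral zero_less_power)
    show "\<kappa> \<noteq> \<infinity>" using g1 v(1) by (metis ennreal_neq_top ennreal_top_mult infinity_ennreal_def)
  qed
  have "(\<integral>\<^sup>+x. f x \<partial>sphere_measure) / emeasure sphere_measure (sphere (0::'a) 1)
     = (of_nat DIM('a) * I) / (of_nat DIM('a) * v)"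
    by (simp only: S nn_integral_sphere_measure[OF f hom] I_def)
  also have "\<dots> = I / v"
    by (subst (1 2) mult.commute) (rule divide_mult_eq, auto)
  also have "\<dots> = (\<kappa> * I) / (\<kappa> * v)"
    using \<kappa> by (subst (1 2) mult.commute) (rule divide_mult_eq[symmetric], auto)
  also have "\<kappa> * I = (\<integral>\<^sup>+x. f x * ennreal (exp (- (norm x)\<^sup>2 / 2)) \<partial>lborel)"
    by (simp only: nn_integral_gaussian_homogeneous[OF f hom] \<kappa>_def I_def)
  finally show ?thesis by (simp add: g1)
qed

section \<open>Gaussian integrals in low dimensions\<close>

text \<open>
  A plane rotation is a composition of substitutions in one variable at a time: with \<open>X = c x - s y\<close>
  and \<open>Y = s x + c y\<close> one has \<open>Y = (s X + y) / c\<close>, so \<open>Y\<close> is first replaced by \<open>y\<close> for fixed \<open>X\<close>, and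
  then \<open>X\<close> by \<open>x\<close> for fixed \<open>y\<close>; the two factors \<open>1 / |c|\<close> and \<open>|c|\<close> cancel. For \<open>c = 0\<close> the
  rotation is an exchange of the variables followed by a reflection.
\<close>

lemma nn_integral_rotation:
  fixes f :: "real \<Rightarrow> real \<Rightarrow> ennreal"
  assumes f[measurable]: "case_prod f \<in> borel_measurable (borel \<Otimes>\<^sub>M borel)" and cs: "c\<^sup>2 + s\<^sup>2 = 1"
  shows "(\<integral>\<^sup>+x. \<integral>\<^sup>+y. f (c * x - s * y) (s * x + c * y) \<partial>lborel \<partial>lborel)
       = (\<integral>\<^sup>+x. \<integral>\<^sup>+y. f x y \<partial>lborel \<partial>lborel)"
proof (cases "c = 0")
  case False
  have "(\<integral>\<^sup>+X. \<integral>\<^sup>+Y. f X Y \<partial>lborel \<partial>lborel)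
      = (\<integral>\<^sup>+X. \<integral>\<^sup>+y. ennreal \<bar>1 / c\<bar> * f X ((s * X + y) / c) \<partial>lborel \<partial>lborel)"
  proof (rule nn_integral_cong)
    fix X
    have "(\<integral>\<^sup>+Y. f X Y \<partial>lborel) = ennreal \<bar>1 / c\<bar> * (\<integral>\<^sup>+y. f X (s * X / c + 1 / c * y) \<partial>lborel)"
      using False by (intro nn_integral_real_affine) auto
    also have "\<dots> = (\<integral>\<^sup>+y. ennreal \<bar>1 / c\<bar> * f X (s * X / c + 1 / c * y) \<partial>lborel)"
      by (intro nn_integral_cmult[symmetric]) measurable
    also have "\<dots> = (\<integral>\<^sup>+y. ennreal \<bar>1 / c\<bar> * f X ((s * X + y) / c) \<partial>lborel)"
      by (simp add: add_divide_distrib)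
    finally show "(\<integral>\<^sup>+Y. f X Y \<partial>lborel) = (\<integral>\<^sup>+y. ennreal \<bar>1 / c\<bar> * f X ((s * X + y) / c) \<partial>lborel)" .
  qed
  also have "\<dots> = (\<integral>\<^sup>+y. \<integral>\<^sup>+X. ennreal \<bar>1 / c\<bar> * f X ((s * X + y) / c) \<partial>lborel \<partial>lborel)"
    by (intro lborel_pair.Fubini') measurable
  also have "\<dots> = (\<integral>\<^sup>+y. \<integral>\<^sup>+x. f (c * x - s * y) (s * x + c * y) \<partial>lborel \<partial>lborel)"
  proof (rule nn_integral_cong)
    fix y
    have eq: "(s * (- s * y + c * x) + y) / c = s * x + c * y" for x
    proof -
      have "s * (- s * y + c * x) + y = (1 - s\<^sup>2) * y + s * c * x"
        by (simp add: algebra_simps power2_eq_square)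
      also have "\<dots> = c * (s * x + c * y)"
        using cs by (simp add: algebra_simps power2_eq_square flip: cs)
      finally show ?thesis using False by simp
    qed
    have "(\<integral>\<^sup>+X. ennreal \<bar>1 / c\<bar> * f X ((s * X + y) / c) \<partial>lborel)
       = ennreal \<bar>c\<bar> * (\<integral>\<^sup>+x. ennreal \<bar>1 / c\<bar> * f (- s * y + c * x) ((s * (- s * y + c * x) + y) / c) \<partial>lborel)"
      using False by (intro nn_integral_real_affine) auto
    also have "\<dots> = ennreal \<bar>c\<bar> * (ennreal \<bar>1 / c\<bar> * (\<integral>\<^sup>+x. f (- s * y + c * x) ((s * (- s * y + c * x) + y) / c) \<partial>lborel))"
      by (subst nn_integral_cmult) measurable
    also have "\<dots> = (ennreal \<bar>c\<bar> * ennreal \<bar>1 / c\<bar>) * (\<integral>\<^sup>+x. f (- s * y + c * x) (s * x + c * y) \<partial>lborel)"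
      unfolding eq by (simp add: mult.assoc)
    also have "ennreal \<bar>c\<bar> * ennreal \<bar>1 / c\<bar> = 1"
      using False by (simp flip: ennreal_mult)
    finally show "(\<integral>\<^sup>+X. ennreal \<bar>1 / c\<bar> * f X ((s * X + y) / c) \<partial>lborel)
       = (\<integral>\<^sup>+x. f (c * x - s * y) (s * x + c * y) \<partial>lborel)" by simp
  qed
  also have "\<dots> = (\<integral>\<^sup>+x. \<integral>\<^sup>+y. f (c * x - s * y) (s * x + c * y) \<partial>lborel \<partial>lborel)"
    by (intro lborel_pair.Fubini') measurable
  finally show ?thesis ..
next
  case True
  then have s: "\<bar>s\<bar> = 1" "s \<noteq> 0" using cs by (auto simp: abs_square_eq_1 power2_eq_1_iff)
  have "(\<integral>\<^sup>+x. \<integral>\<^sup>+y. f (c * x - s * y) (s * x + c * y) \<partial>lborel \<partial>lborel)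
      = (\<integral>\<^sup>+x. \<integral>\<^sup>+y. f y (s * x) \<partial>lborel \<partial>lborel)"
  proof (rule nn_integral_cong)
    fix x
    have "(\<integral>\<^sup>+y. f y (s * x) \<partial>lborel) = ennreal \<bar>- s\<bar> * (\<integral>\<^sup>+y. f (0 + - s * y) (s * x) \<partial>lborel)"
      using s by (intro nn_integral_real_affine) auto
    then show "(\<integral>\<^sup>+y. f (c * x - s * y) (s * x + c * y) \<partial>lborel) = (\<integral>\<^sup>+y. f y (s * x) \<partial>lborel)"
      using s True by simp
  qed
  also have "\<dots> = (\<integral>\<^sup>+y. \<integral>\<^sup>+x. f y (s * x) \<partial>lborel \<partial>lborel)"
    by (intro lborel_pair.Fubini') measurable
  also have "\<dots> = (\<integral>\<^sup>+y. \<integral>\<^sup>+x. f y x \<partial>lborel \<partial>lborel)"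
  proof (rule nn_integral_cong)
    fix y
    have "(\<integral>\<^sup>+x. f y x \<partial>lborel) = ennreal \<bar>s\<bar> * (\<integral>\<^sup>+x. f y (0 + s * x) \<partial>lborel)"
      using s by (intro nn_integral_real_affine) auto
    then show "(\<integral>\<^sup>+x. f y (s * x) \<partial>lborel) = (\<integral>\<^sup>+x. f y x \<partial>lborel)" using s by simp
  qed
  finally show ?thesis .
qed

text \<open>
  The disc of radius \<open>sqrt a\<close> has area \<open>\<pi> a\<close>, and the intervals \<open>{..<a}\<close> generate the Borel sets.
\<close>

lemma distr_sum_squares:
  "distr (lborel :: (real \<times> real) measure) borel (\<lambda>(x, y). x\<^sup>2 + y\<^sup>2)
     = density lborel (\<lambda>w. ennreal pi * indicator {0..} w)" (is "?M = ?N")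
proof (rule measure_eqI_generator_eq)
  let ?E = "range (lessThan :: real \<Rightarrow> real set)"
  show "Int_stable ?E"
  proof (rule Int_stableI, safe)
    fix a b :: real
    show "{..<a} \<inter> {..<b} \<in> ?E" by (rule range_eqI[of _ _ "min a b"]) auto
  qed
  have eq: "emeasure ?M {..<a} = ennreal pi * ennreal a" "emeasure ?N {..<a} = ennreal pi * ennreal a" for a :: real
  proof -
    have "emeasure ?M {..<a} = emeasure lborel ((\<lambda>(x::real, y::real). x\<^sup>2 + y\<^sup>2) -` {..<a})"
      by (subst emeasure_distr) (auto simp: borel_prod[symmetric] space_pair_measure)
    also have "(\<lambda>(x::real, y::real). x\<^sup>2 + y\<^sup>2) -` {..<a} = ball 0 (sqrt a)"
      by (auto simp: norm_Pair)
    also have "emeasure lborel (ball (0 :: real \<times> real) (sqrt a)) = ennreal pi * ennreal a"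
      by (cases "a \<ge> 0") (auto simp: emeasure_ball unit_ball_vol_2 ennreal_mult ball_eq_empty[THEN iffD2] ennreal_neg)
    finally show "emeasure ?M {..<a} = ennreal pi * ennreal a" .
    have "emeasure ?N {..<a} = (\<integral>\<^sup>+w. ennreal pi * indicator {0..<a} w \<partial>lborel)"
      by (subst emeasure_density) (auto intro!: nn_integral_cong simp: indicator_def)
    also have "\<dots> = ennreal pi * ennreal a"
      by (cases "a \<ge> 0") (auto simp: nn_integral_cmult ennreal_neg)
    finally show "emeasure ?N {..<a} = ennreal pi * ennreal a" .
  qed
  show "\<And>X. X \<in> ?E \<Longrightarrow> emeasure ?M X = emeasure ?N X" using eq by auto
  show "sets ?M = sigma_sets UNIV ?E" "sets ?N = sigma_sets UNIV ?E"
    by (simp_all add: borel_Iio)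
  show "range (\<lambda>n. {..<real n}) \<subseteq> ?E" by auto
  show "(\<Union>n. {..<real n}) = UNIV" using reals_Archimedean2 by auto
  show "emeasure ?M {..<real n} \<noteq> \<infinity>" for n by (simp add: eq(1) ennreal_mult_eq_top_iff)
qed auto

lemma nn_integral_polar:
  fixes h :: "real \<Rightarrow> ennreal"
  assumes [measurable]: "h \<in> borel_measurable borel"
  shows "(\<integral>\<^sup>+x. \<integral>\<^sup>+y. h (x\<^sup>2 + y\<^sup>2) \<partial>lborel \<partial>lborel) = ennreal pi * (\<integral>\<^sup>+w. h w * indicator {0..} w \<partial>lborel)"
proof -
  have "(\<integral>\<^sup>+x. \<integral>\<^sup>+y. h (x\<^sup>2 + y\<^sup>2) \<partial>lborel \<partial>lborel) = (\<integral>\<^sup>+p. h ((\<lambda>(x, y). x\<^sup>2 + y\<^sup>2) p) \<partial>(lborel \<Otimes>\<^sub>M lborel))"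
    by (subst lborel.nn_integral_fst[symmetric]) auto
  also have "\<dots> = (\<integral>\<^sup>+w. h w \<partial>distr lborel borel (\<lambda>(x::real, y::real). x\<^sup>2 + y\<^sup>2))"
    by (subst nn_integral_distr) (auto simp: lborel_prod borel_prod[symmetric])
  also have "\<dots> = (\<integral>\<^sup>+w. ennreal pi * (h w * indicator {0..} w) \<partial>lborel)"
    unfolding distr_sum_squares by (subst nn_integral_density) (auto simp: ac_simps)
  also have "\<dots> = ennreal pi * (\<integral>\<^sup>+w. h w * indicator {0..} w \<partial>lborel)"
    by (intro nn_integral_cmult) measurable
  finally show ?thesis .
qed

text \<open>
  The sign of \<open>m - w / 2\<close> changes at \<open>w = 2 m\<close>, and \<open>(w - 2 m + 2) exp (- w / 2)\<close> is an
  antiderivative without the absolute value.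
\<close>

lemma nn_integral_abs_diff_exponential:
  fixes m :: real
  assumes "m \<ge> 0"
  shows "(\<integral>\<^sup>+w. ennreal (\<bar>m - w / 2\<bar> * exp (- w / 2)) * indicator {0..} w \<partial>lborel)
       = ennreal (2 * m - 2 + 4 * exp (- m))"
proof -
  define G where "G w = (w - 2 * m + 2) * exp (- w / 2)" for w :: real
  have G: "(G has_real_derivative (m - w / 2) * exp (- w / 2)) (at w)" for w
    unfolding G_def by (auto intro!: derivative_eq_intros simp: field_simps)
  have 1: "(\<integral>\<^sup>+w. ennreal ((m - w / 2) * exp (- w / 2)) * indicator {0..2 * m} w \<partial>lborel) = ennreal (G (2 * m) - G 0)"
    using assms G by (intro nn_integral_FTC_Icc) (auto intro: has_field_derivative_at_within simp: has_real_derivative_iff_has_vector_derivative[symmetric])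
  have "((\<lambda>w. - G w) \<longlongrightarrow> 0) at_top" unfolding G_def by real_asymp
  then have 2: "(\<integral>\<^sup>+w. ennreal (- ((m - w / 2) * exp (- w / 2))) * indicator {2 * m..} w \<partial>lborel) = ennreal (0 - (- G (2 * m)))"
    using assms G by (intro nn_integral_FTC_atLeast) (auto intro!: DERIV_minus mult_nonpos_nonneg)
  have "(\<integral>\<^sup>+w. ennreal (\<bar>m - w / 2\<bar> * exp (- w / 2)) * indicator {0..} w \<partial>lborel)
     = (\<integral>\<^sup>+w. ennreal ((m - w / 2) * exp (- w / 2)) * indicator {0..2 * m} w
         + ennreal (- ((m - w / 2) * exp (- w / 2))) * indicator {2 * m..} w \<partial>lborel)"
    using assms by (intro nn_integral_cong)
      (auto simp: indicator_def abs_if mult_minus_left[symmetric] simp del: mult_minus_left)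
  also have "\<dots> = ennreal (G (2 * m) - G 0) + ennreal (G (2 * m))"
    using 1 2 by (subst nn_integral_add) auto
  also have "\<dots> = ennreal (2 * m - 2 + 4 * exp (- m))"
  proof -
    have "1 - m \<le> exp (- m)" using exp_ge_add_one_self[of "- m"] by simp
    then show ?thesis by (subst ennreal_plus[symmetric]) (auto simp: G_def algebra_simps)
  qed
  finally show ?thesis .
qed

text \<open>
  The first two terms cancel, because the standard Gaussian has second moment 1; the last one is a
  Gaussian integral with exponent \<open>- 3 x\<^sup>2 / 2\<close>.
\<close>

lemma nn_integral_gaussian_quadratic:
  "(\<integral>\<^sup>+x. ennreal ((2 * x\<^sup>2 - 2 + 4 * exp (- x\<^sup>2)) * exp (- x\<^sup>2 / 2)) \<partial>lborel)
     = ennreal (4 * sqrt (2 * pi / 3))"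
proof -
  have g: "has_bochner_integral lborel (\<lambda>x. exp (- a * x\<^sup>2 / 2)) (sqrt (2 * pi / a))" if "a > 0" for a
    using nn_integral_gaussian_1[OF that] that
    by (intro has_bochner_integral_nn_integral) auto
  have "has_bochner_integral lborel (\<lambda>x. (sqrt (2 * pi)) * (std_normal_density x * x ^ (2 * 1))) (sqrt (2 * pi) * (fact (2 * 1) / (2 ^ 1 * fact 1)))"
    by (intro has_bochner_integral_mult_right std_normal_moment_even)
  then have m2: "has_bochner_integral lborel (\<lambda>x. x\<^sup>2 * exp (- x\<^sup>2 / 2)) (sqrt (2 * pi))"
    by (simp add: normal_density_def mult.commute)
  have "has_bochner_integral lborel
      (\<lambda>x. (2 * (x\<^sup>2 * exp (- x\<^sup>2 / 2)) - 2 * exp (- 1 * x\<^sup>2 / 2)) + 4 * exp (- 3 * x\<^sup>2 / 2))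
      ((2 * sqrt (2 * pi) - 2 * sqrt (2 * pi / 1)) + 4 * sqrt (2 * pi / 3))"
    by (intro has_bochner_integral_add has_bochner_integral_diff has_bochner_integral_mult_right m2 g) auto
  also have "(\<lambda>x. (2 * (x\<^sup>2 * exp (- x\<^sup>2 / 2)) - 2 * exp (- 1 * x\<^sup>2 / 2)) + 4 * exp (- 3 * x\<^sup>2 / 2))
     = (\<lambda>x::real. (2 * x\<^sup>2 - 2 + 4 * exp (- x\<^sup>2)) * exp (- x\<^sup>2 / 2))"
  proof
    fix x :: real
    have "exp (- 3 * x\<^sup>2 / 2) = exp (- x\<^sup>2) * exp (- x\<^sup>2 / 2)"
      by (simp flip: exp_add)
    then show "(2 * (x\<^sup>2 * exp (- x\<^sup>2 / 2)) - 2 * exp (- 1 * x\<^sup>2 / 2)) + 4 * exp (- 3 * x\<^sup>2 / 2)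
       = (2 * x\<^sup>2 - 2 + 4 * exp (- x\<^sup>2)) * exp (- x\<^sup>2 / 2)"
      by (simp add: algebra_simps)
  qed
  finally have h: "has_bochner_integral lborel (\<lambda>x::real. (2 * x\<^sup>2 - 2 + 4 * exp (- x\<^sup>2)) * exp (- x\<^sup>2 / 2)) (4 * sqrt (2 * pi / 3))"
    by simp
  have "2 * x\<^sup>2 - 2 + 4 * exp (- x\<^sup>2) \<ge> 0" for x :: real
  proof -
    have "1 - x\<^sup>2 \<le> exp (- x\<^sup>2)" using exp_ge_add_one_self[of "- x\<^sup>2"] by simp
    moreover have "exp (- x\<^sup>2) > 0" by simp
    ultimately show ?thesis by linarith
  qed
  with h show ?thesis
    by (subst nn_integral_eq_integral) (auto simp: has_bochner_integral_iff)
qed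

text \<open>
  Two rotations diagonalise the quadratic form \<open>a b + a \<tau> + b \<tau>\<close>, whose eigenvalues are \<open>1\<close>, \<open>- 1/2\<close>
  and \<open>- 1/2\<close>: the first one, by 45 degrees in \<open>(a, b)\<close>, gives \<open>(x\<^sup>2 - y\<^sup>2) / 2 + sqrt 2 x \<tau>\<close>; the second
  one, in \<open>(x, \<tau>)\<close>, gives \<open>X\<^sup>2 - (Z\<^sup>2 + y\<^sup>2) / 2\<close>. The two equal eigenvalues then allow polar
  coordinates in \<open>(Z, y)\<close>.
\<close>

lemma nn_integral_abs_det_gaussian:
  "(\<integral>\<^sup>+a. \<integral>\<^sup>+b. \<integral>\<^sup>+\<tau>. ennreal (\<bar>a * b + a * \<tau> + b * \<tau>\<bar> * exp (- (a\<^sup>2 + b\<^sup>2 + \<tau>\<^sup>2) / 2)) \<partial>lborel \<partial>lborel \<partial>lborel)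
     = ennreal (4 * pi * sqrt (2 * pi / 3))"
proof -
  define \<Phi> where "\<Phi> a b \<tau> = ennreal (\<bar>a * b + a * \<tau> + b * \<tau>\<bar> * exp (- (a\<^sup>2 + b\<^sup>2 + \<tau>\<^sup>2) / 2))" for a b \<tau> :: real
  define r s where "r = sqrt (2 :: real)" and "s = sqrt (1 / 3 :: real)"
  have r: "r\<^sup>2 = 2" "r \<noteq> 0" and s: "s\<^sup>2 = 1 / 3" by (simp_all add: r_def s_def)
  have r': "r * r = 2" "r * (r * z) = 2 * z" and s': "s * s = 1 / 3" "s * (s * z) = z / 3" for z
    using r s by (simp_all add: power2_eq_square flip: mult.assoc)
  define \<Psi> where "\<Psi> x \<tau> y = ennreal (\<bar>(x\<^sup>2 - y\<^sup>2) / 2 + r * x * \<tau>\<bar> * exp (- (x\<^sup>2 + y\<^sup>2 + \<tau>\<^sup>2) / 2))" for x \<tau> y :: real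
  \<comment> \<open>Rotation by 45 degrees: \<open>r / 2\<close> is both the sine and the cosine.\<close>
  have "(\<integral>\<^sup>+a. \<integral>\<^sup>+b. \<integral>\<^sup>+\<tau>. \<Phi> a b \<tau> \<partial>lborel \<partial>lborel \<partial>lborel)
     = (\<integral>\<^sup>+x. \<integral>\<^sup>+y. \<integral>\<^sup>+\<tau>. \<Phi> (r / 2 * x - r / 2 * y) (r / 2 * x + r / 2 * y) \<tau> \<partial>lborel \<partial>lborel \<partial>lborel)"
    by (rule nn_integral_rotation[symmetric], unfold \<Phi>_def, measurable) (simp add: power_divide r)
  also have "\<dots> = (\<integral>\<^sup>+x. \<integral>\<^sup>+y. \<integral>\<^sup>+\<tau>. \<Psi> x \<tau> y \<partial>lborel \<partial>lborel \<partial>lborel)"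
  proof -
    have "\<Phi> (r / 2 * x - r / 2 * y) (r / 2 * x + r / 2 * y) \<tau> = \<Psi> x \<tau> y" for x y \<tau>
    proof -
      have "(r / 2 * x - r / 2 * y) * (r / 2 * x + r / 2 * y) + (r / 2 * x - r / 2 * y) * \<tau> + (r / 2 * x + r / 2 * y) * \<tau>
        = (x\<^sup>2 - y\<^sup>2) / 2 + r * x * \<tau>"
        by (simp add: field_simps power2_eq_square r')
      moreover have "(r / 2 * x - r / 2 * y)\<^sup>2 + (r / 2 * x + r / 2 * y)\<^sup>2 = x\<^sup>2 + y\<^sup>2"
        by (simp add: field_simps power2_eq_square r')
      ultimately show ?thesis unfolding \<Phi>_def \<Psi>_def by simp
    qed
    then show ?thesis by simp
  qed
  also have "\<dots> = (\<integral>\<^sup>+x. \<integral>\<^sup>+\<tau>. \<integral>\<^sup>+y. \<Psi> x \<tau> y \<partial>lborel \<partial>lborel \<partial>lborel)"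
    unfolding \<Psi>_def by (rule nn_integral_cong, rule lborel_pair.Fubini') measurable
  \<comment> \<open>The unit eigenvector for the eigenvalue 1 of \<open>x\<^sup>2 / 2 + r x \<tau>\<close> is \<open>(r s, s)\<close>.\<close>
  also have "\<dots> = (\<integral>\<^sup>+X. \<integral>\<^sup>+Z. \<integral>\<^sup>+y. \<Psi> (r * s * X - s * Z) (s * X + r * s * Z) y \<partial>lborel \<partial>lborel \<partial>lborel)"
    by (rule nn_integral_rotation[symmetric], unfold \<Psi>_def, measurable) (simp add: power_mult_distrib r s)
  also have "\<dots> = (\<integral>\<^sup>+X. \<integral>\<^sup>+Z. \<integral>\<^sup>+y. ennreal (\<bar>X\<^sup>2 - (Z\<^sup>2 + y\<^sup>2) / 2\<bar> * exp (- (Z\<^sup>2 + y\<^sup>2) / 2) * exp (- X\<^sup>2 / 2)) \<partial>lborel \<partial>lborel \<partial>lborel)"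
  proof -
    have "\<Psi> (r * s * X - s * Z) (s * X + r * s * Z) y = ennreal (\<bar>X\<^sup>2 - (Z\<^sup>2 + y\<^sup>2) / 2\<bar> * exp (- (Z\<^sup>2 + y\<^sup>2) / 2) * exp (- X\<^sup>2 / 2))" for X Z y
    proof -
      have "((r * s * X - s * Z)\<^sup>2 - y\<^sup>2) / 2 + r * (r * s * X - s * Z) * (s * X + r * s * Z) = X\<^sup>2 - (Z\<^sup>2 + y\<^sup>2) / 2"
        by (simp add: field_simps power2_eq_square r' s' mult.left_commute[of s r])
      moreover have "(r * s * X - s * Z)\<^sup>2 + (s * X + r * s * Z)\<^sup>2 = X\<^sup>2 + Z\<^sup>2"
        by (simp add: field_simps power2_eq_square r' s' mult.left_commute[of s r])
      then have e: "(r * s * X - s * Z)\<^sup>2 + y\<^sup>2 + (s * X + r * s * Z)\<^sup>2 = (Z\<^sup>2 + y\<^sup>2) + X\<^sup>2" by simp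
      have "exp (- ((Z\<^sup>2 + y\<^sup>2) + X\<^sup>2) / 2) = exp (- (Z\<^sup>2 + y\<^sup>2) / 2) * exp (- X\<^sup>2 / 2)"
        by (simp add: add_divide_distrib diff_divide_distrib flip: exp_add)
      ultimately show ?thesis unfolding \<Psi>_def e by (simp only: mult.assoc)
    qed
    then show ?thesis by simp
  qed
  also have "\<dots> = (\<integral>\<^sup>+X. ennreal pi * ennreal ((2 * X\<^sup>2 - 2 + 4 * exp (- X\<^sup>2)) * exp (- X\<^sup>2 / 2)) \<partial>lborel)"
  proof (rule nn_integral_cong)
    fix X :: real
    have "(\<integral>\<^sup>+Z. \<integral>\<^sup>+y. ennreal (\<bar>X\<^sup>2 - (Z\<^sup>2 + y\<^sup>2) / 2\<bar> * exp (- (Z\<^sup>2 + y\<^sup>2) / 2) * exp (- X\<^sup>2 / 2)) \<partial>lborel \<partial>lborel)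
        = ennreal pi * (\<integral>\<^sup>+w. ennreal (\<bar>X\<^sup>2 - w / 2\<bar> * exp (- w / 2) * exp (- X\<^sup>2 / 2)) * indicator {0..} w \<partial>lborel)"
      by (rule nn_integral_polar) measurable
    also have "(\<integral>\<^sup>+w. ennreal (\<bar>X\<^sup>2 - w / 2\<bar> * exp (- w / 2) * exp (- X\<^sup>2 / 2)) * indicator {0..} w \<partial>lborel)
        = (\<integral>\<^sup>+w. ennreal (\<bar>X\<^sup>2 - w / 2\<bar> * exp (- w / 2)) * indicator {0..} w * ennreal (exp (- X\<^sup>2 / 2)) \<partial>lborel)"
      by (intro nn_integral_cong) (auto simp: ennreal_mult'' ac_simps)
    also have "\<dots> = ennreal (2 * X\<^sup>2 - 2 + 4 * exp (- X\<^sup>2)) * ennreal (exp (- X\<^sup>2 / 2))"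
      by (subst nn_integral_multc, measurable) (subst nn_integral_abs_diff_exponential, auto)
    finally show "(\<integral>\<^sup>+Z. \<integral>\<^sup>+y. ennreal (\<bar>X\<^sup>2 - (Z\<^sup>2 + y\<^sup>2) / 2\<bar> * exp (- (Z\<^sup>2 + y\<^sup>2) / 2) * exp (- X\<^sup>2 / 2)) \<partial>lborel \<partial>lborel)
        = ennreal pi * ennreal ((2 * X\<^sup>2 - 2 + 4 * exp (- X\<^sup>2)) * exp (- X\<^sup>2 / 2))"
      by (simp add: ennreal_mult'')
  qed
  also have "\<dots> = ennreal pi * ennreal (4 * sqrt (2 * pi / 3))"
    by (subst nn_integral_cmult, measurable) (simp only: nn_integral_gaussian_quadratic)
  also have "\<dots> = ennreal (4 * pi * sqrt (2 * pi / 3))"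
    by (simp add: ac_simps flip: ennreal_mult)
  finally show ?thesis unfolding \<Phi>_def .
qed

section \<open>Trigonometric waves on the torus\<close>

lemma exhaust_6: "x = 1 \<or> x = 2 \<or> x = 3 \<or> x = 4 \<or> x = 5 \<or> x = 6" for x :: 6
proof (induct x)
  case (of_int z)
  then have "z = 0 \<or> z = 1 \<or> z = 2 \<or> z = 3 \<or> z = 4 \<or> z = 5" by auto
  then show ?case by auto
qed

lemma UNIV_6: "UNIV = {1, 2, 3, 4, 5, 6 :: 6}"
  using exhaust_6 by auto

lemma sum_6: "sum f (UNIV :: 6 set) = f 1 + f 2 + f 3 + f 4 + f 5 + f 6"
  unfolding UNIV_6 by (simp add: ac_simps)

lemma forall_6: "(\<forall>i::6. P i) \<longleftrightarrow> P 1 \<and> P 2 \<and> P 3 \<and> P 4 \<and> P 5 \<and> P 6"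
  by (metis exhaust_6)

definition freq_x :: "6 \<Rightarrow> int" where "freq_x k = (if k \<in> {3, 4} then 0 else 1)"
definition freq_y :: "6 \<Rightarrow> int" where "freq_y k = (if k \<in> {1, 2} then 0 else 1)"
definition phase :: "6 \<Rightarrow> real" where "phase k = (if k \<in> {2, 4, 6} then pi / 2 else 0)"

text \<open>
  The six functions \<open>cos x, sin x, cos y, sin y, cos (x + y), sin (x + y)\<close>, in this order. Writing all of
  them as cosines with a phase makes their products uniform.
\<close>

definition wave :: "6 \<Rightarrow> torus \<Rightarrow> real" where
  "wave k \<theta> = (case rep_torus \<theta> of (x, y) \<Rightarrow> cos (of_int (freq_x k) * x + of_int (freq_y k) * y - phase k))"

lemma torus_of_surj: "\<exists>z. \<theta> = torus_of z"
  by (metis Quotient_torus Quotient_abs_rep)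

lemma torus_of_eq_iff: "torus_of z = torus_of w \<longleftrightarrow> torus_eq z w"
  using Quotient_rel[OF Quotient_torus] equivp_reflp[OF equivp_torus_eq] by metis

lemma cos_plus_of_int_mult_2pi: "cos (a + of_int n * (2 * pi)) = cos (a :: real)"
  using cos.plus_of_int[of a n] by simp

lemma sin_plus_of_int_mult_2pi: "sin (a + of_int n * (2 * pi)) = sin (a :: real)"
  using sin.plus_of_int[of a n] by simp

lemma wave_torus_of:
  "wave k (torus_of (x, y)) = cos (of_int (freq_x k) * x + of_int (freq_y k) * y - phase k)"
proof -
  have "torus_eq (x, y) (rep_torus (torus_of (x, y)))"
    by (metis Quotient_abs_rep Quotient_torus torus_of_eq_iff)
  then obtain i j :: int where r: "rep_torus (torus_of (x, y)) = (x + 2 * pi * of_int i, y + 2 * pi * of_int j)"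
    unfolding torus_eq_def by auto
  have "of_int (freq_x k) * (x + 2 * pi * of_int i) + of_int (freq_y k) * (y + 2 * pi * of_int j) - phase k
     = of_int (freq_x k) * x + of_int (freq_y k) * y - phase k + of_int (freq_x k * i + freq_y k * j) * (2 * pi)"
    by (simp add: algebra_simps)
  then show ?thesis
    unfolding wave_def r prod.case by (simp only: cos_plus_of_int_mult_2pi)
qed

lemma lin_comb_wave_torus_of:
  "lin_comb wave c (torus_of (x, y)) =
     c $ 1 * cos x + c $ 2 * sin x + c $ 3 * cos y + c $ 4 * sin y + c $ 5 * cos (x + y) + c $ 6 * sin (x + y)"
  by (simp add: lin_comb_def sum_6 wave_torus_of freq_x_def freq_y_def phase_def cos_diff)

lemma trig_space_eq_range: "trig_space {(1, 0), (0, 1), (1, 1)} = range (lin_comb wave)"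
proof (intro equalityI subsetI)
  fix v assume "v \<in> trig_space {(1, 0), (0, 1), (1, 1)}"
  then obtain p q r s t u where v: "\<And>x y. v (torus_of (x, y)) =
      p * cos x + q * sin x + r * cos y + s * sin y + t * cos (x + y) + u * sin (x + y)"
    unfolding trig_space_triangle by auto
  define c :: "real^6" where "c = (\<chi> k. if k = 1 then p else if k = 2 then q else if k = 3 then r
    else if k = 4 then s else if k = 5 then t else u)"
  have "v = lin_comb wave c"
  proof
    fix \<theta>
    obtain x y where "\<theta> = torus_of (x, y)" using torus_of_surj by (metis surj_pair)
    then show "v \<theta> = lin_comb wave c \<theta>" by (simp add: v lin_comb_wave_torus_of c_def)
  qed
  then show "v \<in> range (lin_comb wave)" by blast
next
  fix v assume "v \<in> range (lin_comb wave)"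
  then show "v \<in> trig_space {(1, 0), (0, 1), (1, 1)}"
    unfolding trig_space_triangle by (auto simp: lin_comb_wave_torus_of) blast
qed

definition gradient :: "real^6 \<Rightarrow> real \<times> real \<Rightarrow> real \<times> real" where
  "gradient c = (\<lambda>(x, y).
     (- c $ 1 * sin x + c $ 2 * cos x - c $ 5 * sin (x + y) + c $ 6 * cos (x + y),
      - c $ 3 * sin y + c $ 4 * cos y - c $ 5 * sin (x + y) + c $ 6 * cos (x + y)))"

lemma critical_iff_gradient_zero:
  "((lin_comb wave c \<circ> torus_of) has_derivative (\<lambda>_. 0)) (at z) \<longleftrightarrow> gradient c z = 0"
proof -
  obtain x y where z: "z = (x, y)" by fastforce
  have e: "lin_comb wave c \<circ> torus_of = (\<lambda>w. c $ 1 * cos (fst w) + c $ 2 * sin (fst w) + c $ 3 * cos (snd w)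
     + c $ 4 * sin (snd w) + c $ 5 * cos (fst w + snd w) + c $ 6 * sin (fst w + snd w))"
    by (auto simp: fun_eq_iff lin_comb_wave_torus_of)
  have d: "((lin_comb wave c \<circ> torus_of) has_derivative (\<lambda>h. gradient c z \<bullet> h)) (at z)"
    unfolding e gradient_def z
    by (auto intro!: derivative_eq_intros simp: algebra_simps inner_prod_def)
  show ?thesis
  proof
    assume "((lin_comb wave c \<circ> torus_of) has_derivative (\<lambda>_. 0)) (at z)"
    from has_derivative_unique[OF d this] have "gradient c z \<bullet> gradient c z = 0" by meson
    then show "gradient c z = 0" by simp
  next
    assume "gradient c z = 0"
    then show "((lin_comb wave c \<circ> torus_of) has_derivative (\<lambda>_. 0)) (at z)" using d by simp
  qed
qed

definition zero_count :: "(real \<times> real) set \<Rightarrow> real^6 \<Rightarrow> ennreal" where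
  "zero_count D c = emeasure (count_space UNIV) {z \<in> D. gradient c z = 0}"

abbreviation square :: "(real \<times> real) set" where
  "square \<equiv> {0..<2 * pi} \<times> {0..<2 * pi}"

lemma ex_torus_of_square: "\<exists>z\<in>square. \<theta> = torus_of z"
proof -
  obtain x y where \<theta>: "\<theta> = torus_of (x, y)" using torus_of_surj by (metis surj_pair)
  define i j where "i = \<lfloor>x / (2 * pi)\<rfloor>" and "j = \<lfloor>y / (2 * pi)\<rfloor>"
  have "torus_eq (x, y) (x - 2 * pi * of_int i, y - 2 * pi * of_int j)"
    unfolding torus_eq_def by (intro exI[of _ "- i"] exI[of _ "- j"]) simp
  moreover have "0 \<le> t - 2 * pi * of_int \<lfloor>t / (2 * pi)\<rfloor> \<and> t - 2 * pi * of_int \<lfloor>t / (2 * pi)\<rfloor> < 2 * pi" for t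
    using floor_divide_lower[of "2 * pi" t] floor_divide_upper[of "2 * pi" t]
    by (simp add: algebra_simps)
  ultimately show ?thesis
    unfolding \<theta> torus_of_eq_iff i_def j_def by fastforce
qed

lemma inj_on_torus_of_square: "inj_on torus_of square"
proof (rule inj_onI)
  fix z w assume z: "z \<in> square" and w: "w \<in> square" and "torus_of z = torus_of w"
  then obtain i j :: int where e: "w = (fst z + 2 * pi * of_int i, snd z + 2 * pi * of_int j)"
    unfolding torus_of_eq_iff torus_eq_def by auto
  have *: "k = 0" if "0 \<le> t" "t < 2 * pi" "0 \<le> t + 2 * pi * of_int k" "t + 2 * pi * of_int k < 2 * pi" for t and k :: int
  proof -
    have "2 * pi * of_int k < 2 * pi * 1" "2 * pi * (-1) < 2 * pi * of_int k" using that by linarith+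
    then have "of_int k < (1 :: real)" "(-1 :: real) < of_int k" by (simp_all only: mult_less_cancel_left) auto
    then show "k = 0" by linarith
  qed
  have "i = 0" using z w e by (intro *[of "fst z"]) auto
  moreover have "j = 0" using z w e by (intro *[of "snd z"]) auto
  ultimately show "z = w" using e by simp
qed

text \<open>
  Critical points on the torus are counted on the half-open square, which is a fundamental domain.
\<close>

lemma num_critical_points_wave: "num_critical_points (lin_comb wave c) = zero_count square c"
proof -
  let ?Z = "{z \<in> square. gradient c z = 0}"
  have "critical_points (lin_comb wave c) = torus_of ` ?Z"
  proof (intro equalityI subsetI)
    fix \<theta> assume "\<theta> \<in> critical_points (lin_comb wave c)"
    then obtain z where z: "\<theta> = torus_of z" "gradient c z = 0"
      by (auto simp: critical_points_def critical_iff_gradient_zero)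
    obtain w where w: "w \<in> square" "\<theta> = torus_of w" using ex_torus_of_square by blast
    then obtain i j :: int where "w = (fst z + 2 * pi * of_int i, snd z + 2 * pi * of_int j)"
      using z(1) unfolding torus_of_eq_iff torus_eq_def by (metis torus_of_eq_iff torus_eq_def)
    then have e: "w = (fst z + of_int i * (2 * pi), snd z + of_int j * (2 * pi))" by (simp add: ac_simps)
    have e2: "fst z + of_int i * (2 * pi) + (snd z + of_int j * (2 * pi)) = fst z + snd z + of_int (i + j) * (2 * pi)"
      by (simp add: algebra_simps)
    have "gradient c w = gradient c z"
      unfolding e gradient_def prod.case e2 by (simp only: sin_plus_of_int_mult_2pi cos_plus_of_int_mult_2pi case_prod_unfold fst_conv snd_conv)
    then show "\<theta> \<in> torus_of ` ?Z" using w z by auto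
  qed (auto simp: critical_points_def critical_iff_gradient_zero)
  moreover have "inj_on torus_of ?Z" using inj_on_torus_of_square by (rule inj_on_subset) auto
  ultimately show ?thesis
    by (simp add: num_critical_points_def zero_count_def emeasure_count_space finite_image_iff card_image)
qed

lemma integral_cos_period:
  "(LINT y:{0..<2 * pi}|lborel. cos (a + of_int n * y)) = (if n = 0 then 2 * pi * cos a else 0)"
proof -
  have "(LINT y:{0..<2 * pi}|lborel. cos (a + of_int n * y)) = (LINT y|lborel. cos (a + of_int n * y) * indicator {0..2 * pi} y)"
    unfolding set_lebesgue_integral_def using AE_lborel_singleton[of "2 * pi"]
    by (intro integral_cong_AE) (auto simp: indicator_def elim!: eventually_mono)
  also have "\<dots> = (if n = 0 then 2 * pi * cos a else 0)"
  proof (cases "n = 0")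
    case True
    then show ?thesis by simp
  next
    case False
    have "(LINT y|lborel. cos (a + of_int n * y) * indicator {0..2 * pi} y)
       = sin (a + of_int n * (2 * pi)) / of_int n - sin (a + of_int n * 0) / of_int n"
      using False by (intro integral_FTC_Icc_real) (auto intro!: derivative_eq_intros continuous_intros)
    also have "sin (a + of_int n * (2 * pi)) = sin a" by (rule sin_plus_of_int_mult_2pi)
    finally show ?thesis using False by simp
  qed
  finally show ?thesis .
qed

lemma set_integrable_square:
  fixes f :: "real \<times> real \<Rightarrow> real"
  assumes "continuous_on UNIV f"
  shows "set_integrable lborel square f"
proof (rule set_integrable_subset)
  show "set_integrable lborel ({0..2 * pi} \<times> {0..2 * pi}) f"
    unfolding set_integrable_def
    by (rule borel_integrable_compact) (auto intro!: compact_Times continuous_on_subset[OF assms])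
qed (auto simp: borel_Times)

text \<open>
  A nonconstant integer frequency integrates to zero over a full period in at least one variable.
\<close>

lemma integral_cos_square:
  "(LINT z:square|lborel. cos (a + of_int m * fst z + of_int n * snd z))
     = (if m = 0 \<and> n = 0 then 4 * pi\<^sup>2 * cos a else 0)"
proof -
  let ?f = "\<lambda>z. indicator square z *\<^sub>R cos (a + of_int m * fst z + of_int n * snd z)"
  have i: "integrable (lborel \<Otimes>\<^sub>M lborel) ?f"
    using set_integrable_square[of "\<lambda>z. cos (a + of_int m * fst z + of_int n * snd z)"]
    unfolding set_integrable_def lborel_prod by (simp add: continuous_intros)
  have "(LINT z:square|lborel. cos (a + of_int m * fst z + of_int n * snd z)) = (LINT z|(lborel \<Otimes>\<^sub>M lborel). ?f z)"
    by (simp add: set_lebesgue_integral_def lborel_prod)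
  also have "\<dots> = (LINT x|lborel. LINT y|lborel. ?f (x, y))"
    using lborel_pair.integral_fst'[OF i] by simp
  also have "\<dots> = (LINT x:{0..<2 * pi}|lborel. LINT y:{0..<2 * pi}|lborel. cos (a + of_int m * x + of_int n * y))"
    unfolding set_lebesgue_integral_def
    by (intro Bochner_Integration.integral_cong refl) (auto simp: indicator_times mult.assoc)
  also have "\<dots> = (LINT x:{0..<2 * pi}|lborel. (if n = 0 then 2 * pi else 0) * cos (a + of_int m * x))"
    unfolding integral_cos_period by (intro set_lebesgue_integral_cong) auto
  also have "\<dots> = (if n = 0 then 2 * pi else 0) * (if m = 0 then 2 * pi * cos a else 0)"
    by (simp only: set_integral_mult_right integral_cos_period)
  finally show ?thesis by (simp add: power2_eq_square)
qed

text \<open>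
  The product of two waves is half the sum of the waves with the difference and with the sum of the
  frequencies. The sum is never \<open>(0, 0)\<close>, as the frequencies are nonnegative and nonzero. The difference
  is \<open>(0, 0)\<close> only for two waves of the same frequency, and then the cosine of the phase difference
  is \<open>1\<close> or \<open>0\<close>.
\<close>

lemma L2_inner_wave: "L2_inner (wave k) (wave l) = (if k = l then 2 * pi\<^sup>2 else 0)"
proof -
  let ?m = "freq_x" and ?n = "freq_y"
  let ?c = "\<lambda>a m n z. cos (a + of_int m * fst z + of_int n * snd z) :: real"
  have w: "wave k (torus_of z) * wave l (torus_of z)
      = 1 / 2 * ?c (phase l - phase k) (?m k - ?m l) (?n k - ?n l) z
      + 1 / 2 * ?c (- phase l - phase k) (?m k + ?m l) (?n k + ?n l) z" for z
    by (cases z) (simp add: wave_torus_of cos_times_cos algebra_simps)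
  have i: "set_integrable lborel square (\<lambda>z. 1 / 2 * ?c a m n z)" for a m n
    by (intro set_integrable_square continuous_intros)
  have "L2_inner (wave k) (wave l) = 1 / 2 * (LINT z:square|lborel. ?c (phase l - phase k) (?m k - ?m l) (?n k - ?n l) z)
     + 1 / 2 * (LINT z:square|lborel. ?c (- phase l - phase k) (?m k + ?m l) (?n k + ?n l) z)"
    unfolding L2_inner_def w by (subst set_integral_add(2)[OF i i]) (simp only: set_integral_mult_right)
  also have "\<dots> = (if k = l then 2 * pi\<^sup>2 else 0)"
    unfolding integral_cos_square using exhaust_6[of k] exhaust_6[of l]
    by (elim disjE) (simp_all add: freq_x_def freq_y_def phase_def)
  finally show ?thesis .
qed

lemma L2_inner_lin_comb_wave: "L2_inner (lin_comb wave c) (lin_comb wave d) = 2 * pi\<^sup>2 * (c \<bullet> d)"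
proof -
  have i: "set_integrable lborel square (\<lambda>z. wave k (torus_of z) * wave l (torus_of z))" for k l
  proof (rule set_integrable_square)
    have "wave k (torus_of z) * wave l (torus_of z)
      = cos (of_int (freq_x k) * fst z + of_int (freq_y k) * snd z - phase k)
        * cos (of_int (freq_x l) * fst z + of_int (freq_y l) * snd z - phase l)" for z
      by (cases z) (simp add: wave_torus_of)
    then show "continuous_on UNIV (\<lambda>z. wave k (torus_of z) * wave l (torus_of z))"
      by (simp add: continuous_intros)
  qed
  define G where "G k l z = indicator square z *\<^sub>R (wave k (torus_of z) * wave l (torus_of z))" for k l z
  have G: "integrable lborel (G k l)" for k l
    using i[of k l] unfolding set_integrable_def G_def .
  have "L2_inner (lin_comb wave c) (lin_comb wave d)
     = (LINT z:square|lborel. \<Sum>k\<in>UNIV. \<Sum>l\<in>UNIV. (c $ k * d $ l) * (wave k (torus_of z) * wave l (torus_of z)))"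
    by (simp add: L2_inner_def lin_comb_def sum_product ac_simps)
  also have "\<dots> = (LINT z|lborel. (\<Sum>k\<in>UNIV. \<Sum>l\<in>UNIV. (c $ k * d $ l) * G k l z))"
    unfolding set_lebesgue_integral_def G_def by (simp add: sum_distrib_left ac_simps)
  also have "\<dots> = (\<Sum>k\<in>UNIV. \<Sum>l\<in>UNIV. (c $ k * d $ l) * (LINT z|lborel. G k l z))"
    using G by simp
  also have "\<dots> = (\<Sum>k\<in>UNIV. \<Sum>l\<in>UNIV. (c $ k * d $ l) * L2_inner (wave k) (wave l))"
    by (simp add: G_def L2_inner_def set_lebesgue_integral_def)
  also have "\<dots> = 2 * pi\<^sup>2 * (c \<bullet> d)"
    by (simp add: L2_inner_wave inner_vec_def sum_distrib_left if_distrib ac_simps cong: if_cong)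
  finally show ?thesis .
qed

section \<open>The mean as a Gaussian average over coefficients\<close>

lemma inj_lin_comb_wave: "inj (lin_comb wave)"
proof (rule injI)
  fix c d assume "lin_comb wave c = lin_comb wave d"
  then have "2 * pi\<^sup>2 * (c \<bullet> (c - d)) = 2 * pi\<^sup>2 * (d \<bullet> (c - d))"
    by (metis L2_inner_lin_comb_wave)
  then have "(c - d) \<bullet> (c - d) = 0" by (simp add: inner_diff_left)
  then show "c = d" by simp
qed

lemma ex_orthonormal_basis: "\<exists>e :: 6 \<Rightarrow> torus \<Rightarrow> real. L2_orthonormal_basis (range (lin_comb wave)) e"
proof
  define a where "a = 1 / (sqrt 2 * pi)"
  have a: "a \<noteq> 0" "a * a * (2 * pi\<^sup>2) = 1" by (auto simp: a_def power2_eq_square)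
  let ?e = "\<lambda>k. lin_comb wave (axis k a)"
  have e: "lin_comb ?e c = lin_comb wave (a *\<^sub>R c)" for c
    by (simp add: lin_comb_def fun_eq_iff axis_def if_distrib if_distribR ac_simps cong: if_cong)
  have "range (lin_comb ?e) = range (lin_comb wave)"
  proof (intro equalityI subsetI)
    fix v assume "v \<in> range (lin_comb wave)"
    then obtain c where "v = lin_comb wave c" by blast
    then have "v = lin_comb ?e ((1 / a) *\<^sub>R c)" using a(1) by (simp add: e)
    then show "v \<in> range (lin_comb ?e)" by blast
  qed (auto simp: e)
  moreover have "L2_inner (?e i) (?e j) = (if i = j then 1 else 0)" for i j
    using a(2) by (simp add: L2_inner_lin_comb_wave inner_axis_axis ac_simps)
  ultimately show "L2_orthonormal_basis (range (lin_comb wave)) ?e"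
    unfolding L2_orthonormal_basis_def by blast
qed

text \<open>
  Every element of an orthonormal basis is a linear combination of waves, and all waves have squared
  norm \<open>2 \<pi>\<^sup>2\<close>.
\<close>

lemma orthonormal_basis_rotates_waves:
  fixes e :: "6 \<Rightarrow> torus \<Rightarrow> real"
  assumes "L2_orthonormal_basis (range (lin_comb wave)) e"
  obtains A where "orthogonal_transformation A"
    "\<And>x. lin_comb e x = lin_comb wave ((1 / (sqrt 2 * pi)) *\<^sub>R A x)"
proof -
  have "e i \<in> range (lin_comb wave)" for i
  proof -
    have "e i = lin_comb e (axis i 1)"
      by (simp add: lin_comb_def axis_def if_distrib if_distribR fun_eq_iff cong: if_cong)
    then show ?thesis using assms unfolding L2_orthonormal_basis_def by blast
  qed
  then have "\<exists>w. e i = lin_comb wave w" for i by blast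
  then obtain w where w: "\<And>i. e i = lin_comb wave (w i)" by metis
  define A where "A x = (sqrt 2 * pi) *\<^sub>R (\<Sum>i\<in>UNIV. x $ i *\<^sub>R w i)" for x :: "real^6"
  have ww: "2 * pi\<^sup>2 * (w i \<bullet> w j) = (if i = j then 1 else 0)" for i j
    using assms unfolding L2_orthonormal_basis_def w L2_inner_lin_comb_wave by blast
  have "lin_comb e x = lin_comb wave (\<Sum>i\<in>UNIV. x $ i *\<^sub>R w i)" for x
    unfolding w lin_comb_def
    by (rule ext) (simp add: sum_distrib_left sum_distrib_right mult.assoc, rule sum.swap)
  then have "lin_comb e x = lin_comb wave ((1 / (sqrt 2 * pi)) *\<^sub>R A x)" for x
    by (simp add: A_def)
  moreover have "orthogonal_transformation A"
    unfolding orthogonal_transformation_def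
  proof (intro conjI allI)
    show "linear A"
      by (rule linearI) (simp_all add: A_def scaleR_sum_right scaleR_add_left sum.distrib scaleR_add_right mult_ac)
    fix x y
    have "A x \<bullet> A y = 2 * pi\<^sup>2 * ((\<Sum>i\<in>UNIV. x $ i *\<^sub>R w i) \<bullet> (\<Sum>j\<in>UNIV. y $ j *\<^sub>R w j))"
      by (simp add: A_def power2_eq_square)
    also have "\<dots> = 2 * pi\<^sup>2 * (\<Sum>i\<in>UNIV. \<Sum>j\<in>UNIV. x $ i * y $ j * (w i \<bullet> w j))"
      unfolding inner_sum_left by (simp add: inner_sum_right sum_distrib_left mult_ac)
    also have "\<dots> = (\<Sum>i\<in>UNIV. \<Sum>j\<in>UNIV. x $ i * y $ j * (2 * pi\<^sup>2 * (w i \<bullet> w j)))"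
      by (simp add: sum_distrib_left mult.left_commute)
    also have "\<dots> = x \<bullet> y"
      unfolding ww by (simp add: inner_vec_def if_distrib cong: if_cong)
    finally show "A x \<bullet> A y = x \<bullet> y" .
  qed
  ultimately show ?thesis using that by blast
qed

lemma distr_lborel_orthogonal:
  fixes A :: "real^'n::{finite,wellorder} \<Rightarrow> real^'n::_"
  assumes A: "orthogonal_transformation A"
  shows "distr lborel borel A = lborel"
proof (rule lborel_eqI[symmetric])
  have Am: "A \<in> borel_measurable borel"
    using A orthogonal_transformation_linear linear_continuous_on linear_conv_bounded_linear
    by (intro borel_measurable_continuous_onI) blast
  fix l u :: "real^'n::_" assume lu: "\<And>b. b \<in> Basis \<Longrightarrow> l \<bullet> b \<le> u \<bullet> b"
  obtain B where B: "orthogonal_transformation B" "\<And>x. A (B x) = x" "\<And>x. B (A x) = x"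
    using orthogonal_transformation_inv[OF A] orthogonal_transformation_bij[OF A]
    by (metis bij_inv_eq_iff)
  have eq: "A -` box l u = B ` box l u" using B by (auto simp: image_iff) metis
  have BL: "B ` box l u \<in> lmeasurable" and "measure lebesgue (B ` box l u) = measure lebesgue (box l u)"
    using measurable_orthogonal_image[OF B(1)] measure_orthogonal_image[OF B(1)] by auto
  then have "emeasure lebesgue (B ` box l u) = emeasure lebesgue (box l u)"
    by (metis emeasure_eq_measure2 lmeasurable_box)
  moreover have "B ` box l u \<in> sets borel"
    unfolding eq[symmetric] using measurable_sets[OF Am, of "box l u"] by simp
  ultimately have "emeasure lborel (B ` box l u) = emeasure lborel (box l u)" by simp
  then show "emeasure (distr lborel borel A) (box l u) = (\<Prod>b\<in>Basis. (u - l) \<bullet> b)"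
    using lu Am by (simp add: emeasure_distr eq)
qed simp

lemma zero_count_scale: "a \<noteq> 0 \<Longrightarrow> zero_count D (a *\<^sub>R c) = zero_count D c"
proof -
  assume "a \<noteq> 0"
  have "gradient (a *\<^sub>R c) z = a *\<^sub>R gradient c z" for z
    by (cases z) (simp add: gradient_def algebra_simps)
  then show ?thesis using \<open>a \<noteq> 0\<close> by (simp add: zero_count_def)
qed

lemma continuous_gradient: "continuous_on UNIV (\<lambda>(z, c). gradient c z)"
  unfolding gradient_def case_prod_unfold by (intro continuous_intros)

lemma borel_measurable_zero_count_gradient:
  assumes "closed C" "open U"
  shows "zero_count (C \<inter> U) \<in> borel_measurable borel"
  using borel_measurable_zero_count[OF continuous_gradient assms] unfolding zero_count_def[abs_def] .

lemma borel_measurable_zero_count_square: "zero_count square \<in> borel_measurable borel"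
proof -
  have "square = ({0..} \<times> {0..}) \<inter> ({..<2 * pi} \<times> {..<2 * pi})" by auto
  then show ?thesis
    using borel_measurable_zero_count_gradient[of "{0..} \<times> {0..}" "{..<2 * pi} \<times> {..<2 * pi}"]
    by (simp add: closed_Times open_Times)
qed

text \<open>
  The chosen orthonormal basis enters only through an orthogonal map \<open>A\<close>, which preserves both the
  Gaussian density and Lebesgue measure.
\<close>

lemma mean_critical_points_eq_gaussian:
  "mean_critical_points TYPE(6) (trig_space {(1, 0), (0, 1), (1, 1)})
     = (\<integral>\<^sup>+c. zero_count square c * ennreal (exp (- (norm c)\<^sup>2 / 2)) \<partial>lborel) / ennreal ((2 * pi) ^ 3)"
proof -
  define V where "V = range (lin_comb wave)"
  define e where "e = (SOME e :: 6 \<Rightarrow> torus \<Rightarrow> real. L2_orthonormal_basis V e)"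
  have e: "L2_orthonormal_basis V e"
    using ex_orthonormal_basis unfolding e_def V_def by (rule someI_ex)
  obtain A where A: "orthogonal_transformation A"
    and eA: "\<And>x. lin_comb e x = lin_comb wave ((1 / (sqrt 2 * pi)) *\<^sub>R A x)"
    using orthonormal_basis_rotates_waves e unfolding V_def by metis
  let ?L = "lin_comb e" and ?\<sigma> = "sphere_measure :: (real^6) measure"
  have inj: "inj ?L"
  proof (rule injI)
    fix x y assume "?L x = ?L y"
    then have "A x = A y" using injD[OF inj_lin_comb_wave] by (fastforce simp: eA)
    then show "x = y" using orthogonal_transformation_inj[OF A] by (auto dest: injD)
  qed
  have sp: "space ?\<sigma> = sphere 0 1"
    by (simp add: sphere_measure_def space_restrict_space space_scale_measure)
  have L2: "L2_inner (?L x) (?L x) = (norm x)\<^sup>2" for x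
    by (simp add: eA L2_inner_lin_comb_wave orthogonal_transformation_norm[OF A] dot_square_norm power2_eq_square)
  have US: "unit_sphere V = ?L ` sphere 0 1"
  proof -
    have "V = range ?L" using e by (simp add: L2_orthonormal_basis_def)
    moreover have "(norm x)\<^sup>2 = 1 \<longleftrightarrow> norm x = 1" for x :: "real^6"
      by (metis abs_norm_cancel abs_square_eq_1)
    ultimately show ?thesis by (auto simp: unit_sphere_def L2)
  qed
  let ?S = "unit_sphere_measure TYPE(6) V"
  have S: "?S = embed_measure ?\<sigma> ?L" by (simp add: unit_sphere_measure_def e_def)
  have sS: "space ?S = unit_sphere V" by (simp add: S US sp space_embed_measure)
  define f where "f = zero_count square"
  have fL: "num_critical_points (?L x) = f (A x)" for x
    by (simp add: eA num_critical_points_wave f_def zero_count_scale)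
  have Am: "A \<in> borel_measurable borel"
    using A orthogonal_transformation_linear linear_continuous_on linear_conv_bounded_linear
    by (intro borel_measurable_continuous_onI) blast
  have fm: "f \<in> borel_measurable borel" unfolding f_def by (rule borel_measurable_zero_count_square)
  have fA: "(\<lambda>x. f (A x)) \<in> borel_measurable borel" using fm Am by measurable
  have hom: "f (A (r *\<^sub>R x)) = f (A x)" if "r > 0" for r x
    using that orthogonal_transformation_linear[OF A] by (simp add: f_def linear_scale zero_count_scale)
  have "(\<lambda>x. f (A x)) \<in> borel_measurable ?\<sigma>"
  proof -
    have "sets ?\<sigma> = sets (restrict_space borel (sphere 0 1))" by (simp add: sphere_measure_def)
    then show ?thesis using measurable_restrict_space1[OF fA, of "sphere 0 1"] measurable_cong_sets by blast
  qed
  then have nm: "num_critical_points \<in> borel_measurable ?S"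
    unfolding S by (intro measurable_embed_measure1) (simp_all add: fL inj)
  have "(\<integral>\<^sup>+v\<in>unit_sphere V. num_critical_points v \<partial>?S) = (\<integral>\<^sup>+v. num_critical_points v \<partial>?S)"
    by (intro nn_integral_cong) (simp add: sS)
  also have "\<dots> = (\<integral>\<^sup>+x. f (A x) \<partial>?\<sigma>)"
    using nm inj unfolding S by (subst nn_integral_embed_measure) (simp_all add: fL)
  finally have 1: "(\<integral>\<^sup>+v\<in>unit_sphere V. num_critical_points v \<partial>?S) = (\<integral>\<^sup>+x. f (A x) \<partial>?\<sigma>)" .
  have 2: "emeasure ?S (unit_sphere V) = emeasure ?\<sigma> (sphere 0 1)"
    unfolding S US using emeasure_embed_measure_image[OF inj, of "sphere 0 1" ?\<sigma>] sets.top[of ?\<sigma>] sp by simp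
  have "mean_critical_points TYPE(6) V = (\<integral>\<^sup>+x. f (A x) \<partial>?\<sigma>) / emeasure ?\<sigma> (sphere 0 1)"
    unfolding mean_critical_points_def 1 2 ..
  also have "\<dots> = (\<integral>\<^sup>+x. f (A x) * ennreal (exp (- (norm x)\<^sup>2 / 2)) \<partial>lborel) / ennreal (sqrt (2 * pi) ^ DIM(real^6))"
    by (rule sphere_mean_eq_gaussian_mean[OF fA hom])
  also have "sqrt (2 * pi) ^ DIM(real^6) = (2 * pi) ^ 3"
  proof -
    have "sqrt (2 * pi) ^ (2 * 3) = (2 * pi) ^ 3" by (simp only: power_mult) simp
    then show ?thesis by simp
  qed
  also have "(\<integral>\<^sup>+x. f (A x) * ennreal (exp (- (norm x)\<^sup>2 / 2)) \<partial>lborel)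
     = (\<integral>\<^sup>+x. f x * ennreal (exp (- (norm x)\<^sup>2 / 2)) \<partial>distr lborel borel A)"
    using fm Am by (subst nn_integral_distr) (simp_all add: orthogonal_transformation_norm[OF A])
  also have "\<dots> = (\<integral>\<^sup>+x. f x * ennreal (exp (- (norm x)\<^sup>2 / 2)) \<partial>lborel)"
    by (simp add: distr_lborel_orthogonal[OF A])
  finally show ?thesis by (simp add: trig_space_eq_range V_def f_def)
qed

section \<open>Coordinates on the coefficient space\<close>

text \<open>
  The preimage of a box is a box whose side lengths are the same up to their order.
\<close>

lemma distr_lborel_basis_bij:
  fixes T :: "'a::euclidean_space \<Rightarrow> 'b::euclidean_space"
  assumes T: "linear T" and bij: "bij_betw T Basis Basis"
  shows "distr lborel borel T = lborel"
proof (rule lborel_eqI[symmetric])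
  have Tm: "T \<in> borel_measurable borel"
    by (intro borel_measurable_continuous_onI linear_continuous_on T[unfolded linear_conv_bounded_linear])
  have TB: "T b \<in> Basis" if "b \<in> Basis" for b using bij that by (auto simp: bij_betw_def)
  have inner: "T x \<bullet> T b = x \<bullet> b" if b: "b \<in> Basis" for x b
  proof -
    have "T x = (\<Sum>i\<in>Basis. (x \<bullet> i) *\<^sub>R T i)"
      by (subst euclidean_representation[of x, symmetric]) (simp only: linear_sum[OF T] linear_scale[OF T])
    then have "T x \<bullet> T b = (\<Sum>i\<in>Basis. (x \<bullet> i) * (T i \<bullet> T b))" by (simp add: inner_sum_left)
    also have "\<dots> = (\<Sum>i\<in>Basis. if i = b then x \<bullet> b else 0)"
    proof (rule sum.cong)
      fix i :: 'a assume i: "i \<in> Basis"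
      have "T i = T b \<longleftrightarrow> i = b" using bij b i by (auto simp: bij_betw_def inj_on_def)
      then show "(x \<bullet> i) * (T i \<bullet> T b) = (if i = b then x \<bullet> b else 0)"
        using TB[OF i] TB[OF b] by (simp add: inner_Basis)
    qed simp
    finally show ?thesis using b by simp
  qed
  fix l u :: 'b assume lu: "\<And>b. b \<in> Basis \<Longrightarrow> l \<bullet> b \<le> u \<bullet> b"
  define l' u' where "l' = (\<Sum>b\<in>Basis. (l \<bullet> T b) *\<^sub>R b)" and "u' = (\<Sum>b\<in>Basis. (u \<bullet> T b) *\<^sub>R b)"
  have l': "l' \<bullet> b = l \<bullet> T b" "u' \<bullet> b = u \<bullet> T b" if "b \<in> Basis" for b
    using that by (simp_all add: l'_def u'_def)
  have "T -` box l u = box l' u'"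
  proof -
    have "(\<forall>b\<in>Basis. l \<bullet> b < T x \<bullet> b \<and> T x \<bullet> b < u \<bullet> b) \<longleftrightarrow> (\<forall>b\<in>Basis. l \<bullet> T b < T x \<bullet> T b \<and> T x \<bullet> T b < u \<bullet> T b)" for x
      by (subst bij_betw_imp_surj_on[OF bij, symmetric]) blast
    then show ?thesis by (auto simp: box_def l' inner)
  qed
  then have "emeasure (distr lborel borel T) (box l u) = emeasure lborel (box l' u')"
    using Tm by (simp add: emeasure_distr)
  also have "\<dots> = (\<Prod>b\<in>Basis. (u' - l') \<bullet> b)"
    using lu TB by (intro emeasure_lborel_box) (simp add: l')
  also have "(\<Prod>b\<in>Basis. (u' - l') \<bullet> b) = (\<Prod>b\<in>Basis. (u - l) \<bullet> T b)"
    by (intro prod.cong) (simp_all add: l' inner_diff_left)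
  also have "\<dots> = (\<Prod>b\<in>Basis. (u - l) \<bullet> b)" by (rule prod.reindex_bij_betw[OF bij])
  finally show "emeasure (distr lborel borel T) (box l u) = (\<Prod>b\<in>Basis. (u - l) \<bullet> b)" .
qed simp

lemma bij_betw_BasisI:
  fixes T :: "'a::euclidean_space \<Rightarrow> 'b::euclidean_space"
  assumes "inj T" "T ` Basis \<subseteq> Basis" "DIM('a) = DIM('b)"
  shows "bij_betw T Basis Basis"
proof -
  have "inj_on T Basis" using assms(1) by (rule inj_on_subset) simp
  then have "card (T ` Basis) = card (Basis :: 'b set)" using assms(3) by (simp add: card_image)
  then show ?thesis using \<open>inj_on T Basis\<close> assms(2) by (simp add: bij_betw_def card_subset_eq)
qed

definition to_vec2 :: "real \<times> real \<Rightarrow> real^2" where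
  "to_vec2 = (\<lambda>(x, y). \<chi> i. if i = 1 then x else y)"

lemma to_vec2_nth [simp]: "to_vec2 z $ 1 = fst z" "to_vec2 z $ 2 = snd z"
  by (simp_all add: to_vec2_def case_prod_unfold)

lemma to_vec2_bij: "inj to_vec2" "to_vec2 (w $ 1, w $ 2) = w"
  by (auto simp: inj_def vec_eq_iff forall_2)

text \<open>
  The order of the arguments separates the four coefficients \<open>t, u, p, r\<close> that will be held fixed from the
  pair \<open>w = (q, s)\<close> that is integrated first.
\<close>

definition coeffs :: "(real \<times> real \<times> real \<times> real) \<times> (real^2) \<Rightarrow> real^6" where
  "coeffs = (\<lambda>((t, u, p, r), w). \<chi> k. if k = 1 then p else if k = 2 then w $ 1 else if k = 3 then r
     else if k = 4 then w $ 2 else if k = 5 then t else u)"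

lemma coeffs_nth [simp]:
  "coeffs ((t, u, p, r), w) $ 1 = p" "coeffs ((t, u, p, r), w) $ 2 = w $ 1"
  "coeffs ((t, u, p, r), w) $ 3 = r" "coeffs ((t, u, p, r), w) $ 4 = w $ 2"
  "coeffs ((t, u, p, r), w) $ 5 = t" "coeffs ((t, u, p, r), w) $ 6 = u"
  by (simp_all add: coeffs_def)

lemma distr_coeffs: "distr lborel borel coeffs = lborel"
proof (rule distr_lborel_basis_bij)
  show "linear coeffs" by (rule linearI) (auto simp: vec_eq_iff forall_6)
  have "inj coeffs" by (rule injI) (auto simp: vec_eq_iff forall_6 forall_2)
  moreover have "coeffs ` Basis \<subseteq> {axis 1 1, axis 2 1, axis 3 1, axis 4 1, axis 5 1, axis 6 1}"
  proof
    fix v assume "v \<in> coeffs ` Basis"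
    then obtain b where b: "b \<in> Basis" "v = coeffs b" by blast
    then consider "b = ((1, 0, 0, 0), 0)" | "b = ((0, 1, 0, 0), 0)" | "b = ((0, 0, 1, 0), 0)" | "b = ((0, 0, 0, 1), 0)"
      | i where "b = ((0, 0, 0, 0), axis i 1)"
      by (auto simp: Basis_prod_def Basis_vec_def zero_prod_def)
    then show "v \<in> {axis 1 1, axis 2 1, axis 3 1, axis 4 1, axis 5 1, axis 6 1}"
    proof cases
      case (5 i)
      then show ?thesis using exhaust_2[of i] b(2) by (auto simp: vec_eq_iff forall_6 axis_def)
    qed (use b(2) in \<open>simp_all add: vec_eq_iff forall_6 axis_def\<close>)
  qed
  then have "coeffs ` Basis \<subseteq> Basis" by (rule subset_trans) (simp add: axis_in_Basis_iff)
  ultimately show "bij_betw coeffs Basis Basis" by (intro bij_betw_BasisI) simp_all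
qed

lemma norm_coeffs: "(norm (coeffs ((t, u, p, r), w)))\<^sup>2 = t\<^sup>2 + u\<^sup>2 + p\<^sup>2 + r\<^sup>2 + (norm w)\<^sup>2"
  by (simp add: power2_norm_eq_inner inner_vec_def sum_6 sum_2) (simp add: power2_eq_square)

lemma measurable_coeffs [measurable]: "coeffs \<in> borel_measurable borel"
proof (rule borel_measurable_continuous_onI)
  have "linear coeffs" by (rule linearI) (auto simp: vec_eq_iff forall_6)
  then show "continuous_on UNIV coeffs"
    unfolding linear_conv_bounded_linear by (rule linear_continuous_on)
qed


section \<open>Functions with a critical point on a fixed line\<close>

text \<open>
  A parametrisation of the functions that are critical at \<open>(x, y)\<close>: their three frequency components,
  rotated to the point, have the same component \<open>k\<close>.
\<close>

definition crit_coeffs :: "real \<Rightarrow> real \<Rightarrow> real \<times> real \<times> real \<times> real \<Rightarrow> real^6" where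
  "crit_coeffs x y = (\<lambda>(a, b, t, u). let k = t * sin (x + y) - u * cos (x + y) in
     (a * cos x - k * sin x) *\<^sub>R axis 1 1 + (a * sin x + k * cos x) *\<^sub>R axis 2 1
     + (b * cos y - k * sin y) *\<^sub>R axis 3 1 + (b * sin y + k * cos y) *\<^sub>R axis 4 1
     + t *\<^sub>R axis 5 1 + u *\<^sub>R axis 6 1)"

lemma gradient_zero_imp_crit_coeffs:
  assumes "gradient c (x, y) = 0"
  shows "c \<in> range (crit_coeffs x y)"
proof
  let ?a = "c $ 1 * cos x + c $ 2 * sin x" and ?b = "c $ 3 * cos y + c $ 4 * sin y"
  let ?k = "c $ 5 * sin (x + y) - c $ 6 * cos (x + y)"
  have k: "?k = - c $ 1 * sin x + c $ 2 * cos x" "?k = - c $ 3 * sin y + c $ 4 * cos y"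
    using assms by (simp_all add: gradient_def zero_prod_def)
  have 1: "(p * cos v + q * sin v) * cos v - (- p * sin v + q * cos v) * sin v = p"
    "(p * cos v + q * sin v) * sin v + (- p * sin v + q * cos v) * cos v = q" for p q v :: real
  proof -
    have "(p * cos v + q * sin v) * cos v - (- p * sin v + q * cos v) * sin v = p * ((sin v)\<^sup>2 + (cos v)\<^sup>2)"
      "(p * cos v + q * sin v) * sin v + (- p * sin v + q * cos v) * cos v = q * ((sin v)\<^sup>2 + (cos v)\<^sup>2)"
      by (simp_all add: algebra_simps power2_eq_square del: sin_cos_squared_add sin_cos_squared_add2 sin_cos_squared_add3)
    then show "(p * cos v + q * sin v) * cos v - (- p * sin v + q * cos v) * sin v = p"
      "(p * cos v + q * sin v) * sin v + (- p * sin v + q * cos v) * cos v = q"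
      by (simp_all only: sin_cos_squared_add mult_1_right)
  qed
  show "c = crit_coeffs x y (?a, ?b, c $ 5, c $ 6)"
    unfolding crit_coeffs_def prod.case Let_def vec_eq_iff forall_6
    using 1[of "c $ 1" x "c $ 2"] 1[of "c $ 3" y "c $ 4"] k by (simp add: axis_def)
qed simp

text \<open>
  Functions with a critical point on a fixed line form the image of a smooth map from a
  five-dimensional space, given by the position on the line and the four parameters of \<open>crit_coeffs\<close>.
\<close>

lemma negligible_critical_on_line:
  "negligible {c. \<exists>y. gradient c (x0, y) = 0}" "negligible {c. \<exists>x. gradient c (x, y0) = 0}"
proof -
  have "negligible ((\<lambda>(y, q). crit_coeffs x0 y q) ` UNIV)"
  proof (rule negligible_differentiable_image_lowdim)
    show "(\<lambda>(y, q). crit_coeffs x0 y q) differentiable_on UNIV"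
      unfolding differentiable_on_def differentiable_def crit_coeffs_def case_prod_unfold Let_def
      by (intro ballI exI) (auto intro!: derivative_eq_intros)
  qed simp
  then show "negligible {c. \<exists>y. gradient c (x0, y) = 0}"
    by (rule negligible_subset) (use gradient_zero_imp_crit_coeffs in fastforce)
  have "negligible ((\<lambda>(x, q). crit_coeffs x y0 q) ` UNIV)"
  proof (rule negligible_differentiable_image_lowdim)
    show "(\<lambda>(x, q). crit_coeffs x y0 q) differentiable_on UNIV"
      unfolding differentiable_on_def differentiable_def crit_coeffs_def case_prod_unfold Let_def
      by (intro ballI exI) (auto intro!: derivative_eq_intros)
  qed simp
  then show "negligible {c. \<exists>x. gradient c (x, y0) = 0}"
    by (rule negligible_subset) (use gradient_zero_imp_crit_coeffs in fastforce)
qed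

text \<open>
  The part of the square on which \<open>q\<close> and \<open>s\<close> are determined by the other coefficients. The left and
  lower sides are removed to make it open.
\<close>

definition chart :: "(real \<times> real) set" where
  "chart = {(x, y). 0 < x \<and> x < 2 * pi \<and> cos x \<noteq> 0 \<and> 0 < y \<and> y < 2 * pi \<and> cos y \<noteq> 0}"

lemma countable_cos_zeros: "countable {x :: real. cos x = 0}"
proof -
  have "{x :: real. cos x = 0} \<subseteq> range (\<lambda>i :: int. of_int i * (pi / 2))"
    by (auto simp: cos_zero_iff_int)
  then show ?thesis by (rule countable_subset) simp
qed

lemma AE_zero_count_chart: "AE c in lebesgue. zero_count square c = zero_count chart c"
proof -
  define X where "X = insert 0 {x :: real. cos x = 0}"
  have "countable X" by (simp add: X_def countable_cos_zeros)
  define N where "N = (\<Union>x\<in>X. {c. \<exists>y. gradient c (x, y) = 0} \<union> {c. \<exists>y. gradient c (y, x) = 0})"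
  have "negligible N"
    unfolding N_def using \<open>countable X\<close>
    by (intro negligible_countable_Union) (auto intro: negligible_Un negligible_critical_on_line)
  then have "N \<in> null_sets lebesgue" by (simp only: negligible_iff_null_sets)
  then have "AE c in lebesgue. c \<notin> N" by (rule AE_not_in)
  then show ?thesis
  proof eventually_elim
    case (elim c)
    then have nz: "gradient c (x, y) \<noteq> 0 \<and> gradient c (y, x) \<noteq> 0" if "x \<in> X" for x y
      using that unfolding N_def by blast
    have "{z \<in> square. gradient c z = 0} = {z \<in> chart. gradient c z = 0}"
    proof (intro equalityI subsetI)
      fix z assume z: "z \<in> {z \<in> square. gradient c z = 0}"
      obtain x y where xy: "z = (x, y)" by fastforce
      have "x \<notin> X" "y \<notin> X" using nz z xy by auto
      then show "z \<in> {z \<in> chart. gradient c z = 0}" using z xy by (auto simp: chart_def X_def)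
    qed (auto simp: chart_def)
    then show ?case by (simp add: zero_count_def)
  qed
qed

section \<open>The Kac-Rice density at a point\<close>

text \<open>
  For given \<open>k\<close> the points \<open>(r, q)\<close> with \<open>q cos v - r sin v = k\<close> form a line, described either by its
  coordinate \<open>r\<close> or by the rotated coordinate \<open>b\<close>.
\<close>

lemma nn_integral_parametrize_line:
  fixes \<Phi> :: "real \<Rightarrow> real \<Rightarrow> ennreal"
  assumes v: "cos v \<noteq> 0" and \<Phi>[measurable]: "case_prod \<Phi> \<in> borel_measurable (borel \<Otimes>\<^sub>M borel)"
  shows "(\<integral>\<^sup>+r. \<Phi> r ((r * sin v + k) / cos v) \<partial>lborel)
    = ennreal \<bar>cos v\<bar> * (\<integral>\<^sup>+b. \<Phi> (b * cos v - k * sin v) (b * sin v + k * cos v) \<partial>lborel)"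
proof -
  have "(\<integral>\<^sup>+r. \<Phi> r ((r * sin v + k) / cos v) \<partial>lborel)
    = ennreal \<bar>cos v\<bar> * (\<integral>\<^sup>+b. \<Phi> (- k * sin v + cos v * b) (((- k * sin v + cos v * b) * sin v + k) / cos v) \<partial>lborel)"
    by (rule nn_integral_real_affine[OF _ v]) measurable
  moreover have "((- k * sin v + cos v * b) * sin v + k) / cos v = b * sin v + k * cos v" for b
  proof -
    have "(- k * sin v + cos v * b) * sin v + k = cos v * (b * sin v) + k * (1 - (sin v)\<^sup>2)"
      by (simp add: algebra_simps power2_eq_square)
    also have "\<dots> = cos v * (b * sin v + k * cos v)"
      unfolding cos_squared_eq[symmetric] by (simp add: algebra_simps power2_eq_square)
    finally show ?thesis using v by simp
  qed
  ultimately show ?thesis by (simp add: algebra_simps)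
qed

lemma pythagoras_weighted:
  "(a * cos v - k * sin v) * cos v + (a * sin v + k * cos v) * sin v = a"
  "(a * cos v - k * sin v)\<^sup>2 + (a * sin v + k * cos v)\<^sup>2 = a\<^sup>2 + k\<^sup>2" for a k v :: real
proof -
  have "(a * cos v - k * sin v) * cos v + (a * sin v + k * cos v) * sin v = a * ((sin v)\<^sup>2 + (cos v)\<^sup>2)"
    "(a * cos v - k * sin v)\<^sup>2 + (a * sin v + k * cos v)\<^sup>2 = (a\<^sup>2 + k\<^sup>2) * ((sin v)\<^sup>2 + (cos v)\<^sup>2)"
    by (simp_all add: algebra_simps power2_eq_square del: sin_cos_squared_add sin_cos_squared_add2 sin_cos_squared_add3)
  then show "(a * cos v - k * sin v) * cos v + (a * sin v + k * cos v) * sin v = a"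
    "(a * cos v - k * sin v)\<^sup>2 + (a * sin v + k * cos v)\<^sup>2 = a\<^sup>2 + k\<^sup>2"
    by (simp_all only: sin_cos_squared_add mult_1_right)
qed

text \<open>
  The absolute Hessian determinant times the Gaussian weight, for functions that are critical at a given
  point, in the rotated coordinates.
\<close>

definition hess_density :: "real \<Rightarrow> real \<Rightarrow> real \<Rightarrow> real \<Rightarrow> real" where
  "hess_density \<tau> k a b = \<bar>a * b + a * \<tau> + b * \<tau>\<bar> * exp (- (a\<^sup>2 + b\<^sup>2 + \<tau>\<^sup>2 + 3 * k\<^sup>2) / 2)"

lemma nn_integral_hess_density:
  "(\<integral>\<^sup>+\<tau>. \<integral>\<^sup>+k. \<integral>\<^sup>+a. \<integral>\<^sup>+b. ennreal (hess_density \<tau> k a b) \<partial>lborel \<partial>lborel \<partial>lborel \<partial>lborel) = ennreal (8 * pi\<^sup>2 / 3)"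
proof -
  define \<Psi> where "\<Psi> \<tau> = (\<integral>\<^sup>+a. \<integral>\<^sup>+b. ennreal (\<bar>\<tau> * a + \<tau> * b + a * b\<bar> * exp (- (\<tau>\<^sup>2 + a\<^sup>2 + b\<^sup>2) / 2)) \<partial>lborel \<partial>lborel)" for \<tau>
  have [measurable]: "\<Psi> \<in> borel_measurable borel" unfolding \<Psi>_def by measurable
  have "(\<integral>\<^sup>+a. \<integral>\<^sup>+b. ennreal (hess_density \<tau> k a b) \<partial>lborel \<partial>lborel) = ennreal (exp (- 3 * k\<^sup>2 / 2)) * \<Psi> \<tau>" for \<tau> k
  proof -
    have "hess_density \<tau> k a b = exp (- 3 * k\<^sup>2 / 2) * (\<bar>\<tau> * a + \<tau> * b + a * b\<bar> * exp (- (\<tau>\<^sup>2 + a\<^sup>2 + b\<^sup>2) / 2))" for a b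
    proof -
      have "exp (- (a\<^sup>2 + b\<^sup>2 + \<tau>\<^sup>2 + 3 * k\<^sup>2) / 2) = exp (- 3 * k\<^sup>2 / 2) * exp (- (\<tau>\<^sup>2 + a\<^sup>2 + b\<^sup>2) / 2)"
        unfolding exp_add[symmetric] by (rule arg_cong[where f = exp]) (simp add: field_simps)
      then show ?thesis by (simp add: hess_density_def ac_simps)
    qed
    then have "ennreal (hess_density \<tau> k a b) = ennreal (exp (- 3 * k\<^sup>2 / 2)) * ennreal (\<bar>\<tau> * a + \<tau> * b + a * b\<bar> * exp (- (\<tau>\<^sup>2 + a\<^sup>2 + b\<^sup>2) / 2))" for a b
      by (simp add: ennreal_mult')
    then show ?thesis unfolding \<Psi>_def
      by (simp add: nn_integral_cmult)
  qed
  then have "(\<integral>\<^sup>+\<tau>. \<integral>\<^sup>+k. \<integral>\<^sup>+a. \<integral>\<^sup>+b. ennreal (hess_density \<tau> k a b) \<partial>lborel \<partial>lborel \<partial>lborel \<partial>lborel)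
     = (\<integral>\<^sup>+\<tau>. (\<integral>\<^sup>+k. ennreal (exp (- 3 * k\<^sup>2 / 2)) * \<Psi> \<tau> \<partial>lborel) \<partial>lborel)" by simp
  also have "\<dots> = (\<integral>\<^sup>+\<tau>. ennreal (sqrt (2 * pi / 3)) * \<Psi> \<tau> \<partial>lborel)"
    using nn_integral_gaussian_1[of 3] by (intro nn_integral_cong) (simp add: nn_integral_multc)
  also have "\<dots> = ennreal (sqrt (2 * pi / 3)) * (\<integral>\<^sup>+\<tau>. \<Psi> \<tau> \<partial>lborel)"
    by (intro nn_integral_cmult) measurable
  also have "(\<integral>\<^sup>+\<tau>. \<Psi> \<tau> \<partial>lborel) = ennreal (4 * pi * sqrt (2 * pi / 3))"
    unfolding \<Psi>_def by (rule nn_integral_abs_det_gaussian)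
  also have "ennreal (sqrt (2 * pi / 3)) * ennreal (4 * pi * sqrt (2 * pi / 3)) = ennreal (8 * pi\<^sup>2 / 3)"
  proof -
    have "sqrt (2 * pi / 3) * (4 * pi * sqrt (2 * pi / 3)) = 4 * pi * (sqrt (2 * pi / 3))\<^sup>2"
      by (simp add: power2_eq_square)
    also have "\<dots> = 8 * pi\<^sup>2 / 3" by (simp add: power2_eq_square)
    finally show ?thesis by (simp flip: ennreal_mult)
  qed
  finally show ?thesis .
qed

text \<open>
  The same quantity in the coefficients \<open>t, u, p, r\<close>, where the determinant is the Jacobian of
  \<open>(x, y) \<mapsto> (q, s)\<close>, that is, the Hessian determinant divided by \<open>cos x cos y\<close>.
\<close>

definition kac_rice_density :: "real \<Rightarrow> real \<Rightarrow> real \<Rightarrow> real \<Rightarrow> real \<Rightarrow> real \<Rightarrow> real" where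
  "kac_rice_density x y t u p r = (let k = t * sin (x + y) - u * cos (x + y); \<tau> = t * cos (x + y) + u * sin (x + y);
      q = (p * sin x + k) / cos x; s = (r * sin y + k) / cos y in
    \<bar>(p * cos x + q * sin x + \<tau>) / cos x * ((r * cos y + s * sin y + \<tau>) / cos y) - \<tau> / cos x * (\<tau> / cos y)\<bar>
     * exp (- (t\<^sup>2 + u\<^sup>2 + p\<^sup>2 + r\<^sup>2 + (q\<^sup>2 + s\<^sup>2)) / 2))"

text \<open>
  In the two frequencies \<open>(1, 0)\<close> and \<open>(0, 1)\<close> one passes to the rotated coordinates \<open>a\<close> and \<open>b\<close>; the
  factors \<open>|cos x|\<close> and \<open>|cos y|\<close> cancel the denominator of the Jacobian. In the third frequency one
  rotates \<open>(t, u)\<close> to \<open>(\<tau>, - k)\<close>. The point \<open>(x, y)\<close> then disappears from the integral.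
\<close>

lemma nn_integral_kac_rice_density:
  assumes x: "cos x \<noteq> 0" and y: "cos y \<noteq> 0"
  shows "(\<integral>\<^sup>+t. \<integral>\<^sup>+u. \<integral>\<^sup>+p. \<integral>\<^sup>+r. ennreal (kac_rice_density x y t u p r) \<partial>lborel \<partial>lborel \<partial>lborel \<partial>lborel)
    = ennreal (8 * pi\<^sup>2 / 3)"
proof -
  define c s where "c = cos (x + y)" and "s = - sin (x + y)"
  define \<Psi> where "\<Psi> \<tau> k = (\<integral>\<^sup>+a. \<integral>\<^sup>+b. ennreal (hess_density \<tau> k a b) \<partial>lborel \<partial>lborel)" for \<tau> k
  have inner: "(\<integral>\<^sup>+p. \<integral>\<^sup>+r. ennreal (kac_rice_density x y t u p r) \<partial>lborel \<partial>lborel) = \<Psi> (c * t - s * u) (s * t + c * u)" for t u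
  proof -
    define k \<tau> where "k = t * sin (x + y) - u * cos (x + y)" and "\<tau> = t * cos (x + y) + u * sin (x + y)"
    have tu: "t\<^sup>2 + u\<^sup>2 = \<tau>\<^sup>2 + k\<^sup>2"
    proof -
      have "\<tau>\<^sup>2 + k\<^sup>2 = (t\<^sup>2 + u\<^sup>2) * ((sin (x + y))\<^sup>2 + (cos (x + y))\<^sup>2)"
        unfolding k_def \<tau>_def
        by (simp add: algebra_simps power2_eq_square del: sin_cos_squared_add sin_cos_squared_add2 sin_cos_squared_add3)
      then show ?thesis by (simp only: sin_cos_squared_add mult_1_right)
    qed
    define D where "D p q r s = \<bar>(p * cos x + q * sin x + \<tau>) * (r * cos y + s * sin y + \<tau>) - \<tau>\<^sup>2\<bar>
       * exp (- (\<tau>\<^sup>2 + k\<^sup>2 + (p\<^sup>2 + q\<^sup>2) + (r\<^sup>2 + s\<^sup>2)) / 2)" for p q r s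
    define J where "J = 1 / (\<bar>cos x\<bar> * \<bar>cos y\<bar>)"
    have J: "J \<ge> 0" "\<bar>cos x\<bar> * (\<bar>cos y\<bar> * J) = 1" using x y by (simp_all add: J_def)
    have e: "ennreal (kac_rice_density x y t u p r) = ennreal (J * D p ((p * sin x + k) / cos x) r ((r * sin y + k) / cos y))" for p r
    proof -
      define q s where "q = (p * sin x + k) / cos x" and "s = (r * sin y + k) / cos y"
      have "(p * cos x + q * sin x + \<tau>) / cos x * ((r * cos y + s * sin y + \<tau>) / cos y) - \<tau> / cos x * (\<tau> / cos y)
        = ((p * cos x + q * sin x + \<tau>) * (r * cos y + s * sin y + \<tau>) - \<tau>\<^sup>2) / (cos x * cos y)"
        by (simp add: diff_divide_distrib power2_eq_square)
      moreover have "t\<^sup>2 + u\<^sup>2 + p\<^sup>2 + r\<^sup>2 + (q\<^sup>2 + s\<^sup>2) = \<tau>\<^sup>2 + k\<^sup>2 + (p\<^sup>2 + q\<^sup>2) + (r\<^sup>2 + s\<^sup>2)"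
        using tu by simp
      ultimately show ?thesis
        unfolding kac_rice_density_def Let_def k_def[symmetric] \<tau>_def[symmetric] q_def[symmetric] s_def[symmetric] D_def J_def
        by (simp add: abs_mult)
    qed
    have "(\<integral>\<^sup>+p. \<integral>\<^sup>+r. ennreal (kac_rice_density x y t u p r) \<partial>lborel \<partial>lborel)
      = (\<integral>\<^sup>+p. ennreal \<bar>cos y\<bar> * (\<integral>\<^sup>+b. ennreal (J * D p ((p * sin x + k) / cos x) (b * cos y - k * sin y) (b * sin y + k * cos y)) \<partial>lborel) \<partial>lborel)"
      unfolding e by (intro nn_integral_cong nn_integral_parametrize_line[OF y]) (unfold D_def, measurable)
    also have "\<dots> = ennreal \<bar>cos x\<bar> * (\<integral>\<^sup>+a. ennreal \<bar>cos y\<bar> * (\<integral>\<^sup>+b. ennreal (J * D (a * cos x - k * sin x) (a * sin x + k * cos x) (b * cos y - k * sin y) (b * sin y + k * cos y)) \<partial>lborel) \<partial>lborel)"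
      by (rule nn_integral_parametrize_line[OF x]) (unfold D_def, measurable)
    also have "\<dots> = ennreal \<bar>cos x\<bar> * (\<integral>\<^sup>+a. ennreal \<bar>cos y\<bar> * (\<integral>\<^sup>+b. ennreal J * ennreal (hess_density \<tau> k a b) \<partial>lborel) \<partial>lborel)"
    proof -
      \<comment> \<open>Along the adapted coordinates \<open>p cos x + q sin x = a\<close> and \<open>p\<^sup>2 + q\<^sup>2 = a\<^sup>2 + k\<^sup>2\<close>.\<close>
      have "D (a * cos x - k * sin x) (a * sin x + k * cos x) (b * cos y - k * sin y) (b * sin y + k * cos y) = hess_density \<tau> k a b" for a b
      proof -
        have "(a + \<tau>) * (b + \<tau>) - \<tau>\<^sup>2 = a * b + a * \<tau> + b * \<tau>" by (simp add: algebra_simps power2_eq_square)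
        moreover have "\<tau>\<^sup>2 + k\<^sup>2 + (a\<^sup>2 + k\<^sup>2) + (b\<^sup>2 + k\<^sup>2) = a\<^sup>2 + b\<^sup>2 + \<tau>\<^sup>2 + 3 * k\<^sup>2" by simp
        ultimately show ?thesis unfolding D_def pythagoras_weighted hess_density_def by (simp only:)
      qed
      then show ?thesis using J(1) by (simp add: ennreal_mult')
    qed
    also have "\<dots> = (ennreal \<bar>cos x\<bar> * (ennreal \<bar>cos y\<bar> * ennreal J)) * \<Psi> \<tau> k"
    proof -
      have [measurable]: "(\<lambda>b. ennreal (hess_density \<tau> k a b)) \<in> borel_measurable lborel" for a
        unfolding hess_density_def by measurable
      have [measurable]: "(\<lambda>a. \<integral>\<^sup>+b. ennreal (hess_density \<tau> k a b) \<partial>lborel) \<in> borel_measurable lborel"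
        unfolding hess_density_def by measurable
      show ?thesis unfolding \<Psi>_def by (simp add: nn_integral_cmult mult.assoc)
    qed
    also have "ennreal \<bar>cos x\<bar> * (ennreal \<bar>cos y\<bar> * ennreal J) = 1"
      using J by (simp flip: ennreal_mult)
    also have "1 * \<Psi> \<tau> k = \<Psi> (c * t - s * u) (s * t + c * u)"
    proof -
      \<comment> \<open>The rotation yields \<open>- k\<close> in place of \<open>k\<close>, but the density is even in \<open>k\<close>.\<close>
      have "c * t - s * u = \<tau>" "s * t + c * u = - k" by (simp_all add: c_def s_def \<tau>_def k_def)
      then show ?thesis by (simp add: \<Psi>_def hess_density_def)
    qed
    finally show ?thesis .
  qed
  have "(\<integral>\<^sup>+t. \<integral>\<^sup>+u. \<integral>\<^sup>+p. \<integral>\<^sup>+r. ennreal (kac_rice_density x y t u p r) \<partial>lborel \<partial>lborel \<partial>lborel \<partial>lborel)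
     = (\<integral>\<^sup>+t. \<integral>\<^sup>+u. \<Psi> (c * t - s * u) (s * t + c * u) \<partial>lborel \<partial>lborel)"
    unfolding inner ..
  also have "\<dots> = (\<integral>\<^sup>+\<tau>. \<integral>\<^sup>+k. \<Psi> \<tau> k \<partial>lborel \<partial>lborel)"
  proof (rule nn_integral_rotation)
    show "case_prod \<Psi> \<in> borel_measurable (borel \<Otimes>\<^sub>M borel)"
      unfolding \<Psi>_def hess_density_def by measurable
    show "c\<^sup>2 + s\<^sup>2 = 1" by (simp add: c_def s_def)
  qed
  also have "\<dots> = ennreal (8 * pi\<^sup>2 / 3)"
    unfolding \<Psi>_def by (rule nn_integral_hess_density)
  finally show ?thesis .
qed

section \<open>The coefficients that make a given point critical\<close>

text \<open>
  The pair \<open>(q, s)\<close> for which \<open>z\<close> is critical, given the other four coefficients.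
\<close>

definition matching_coeffs :: "real \<times> real \<times> real \<times> real \<Rightarrow> real^2 \<Rightarrow> real^2" where
  "matching_coeffs = (\<lambda>(t, u, p, r) z. let k = t * sin (z $ 1 + z $ 2) - u * cos (z $ 1 + z $ 2) in
     ((p * sin (z $ 1) + k) / cos (z $ 1)) *\<^sub>R axis 1 1 + ((r * sin (z $ 2) + k) / cos (z $ 2)) *\<^sub>R axis 2 1)"

definition jacobian :: "real \<times> real \<times> real \<times> real \<Rightarrow> real^2 \<Rightarrow> real^2^2" where
  "jacobian = (\<lambda>(t, u, p, r) z. let x = z $ 1; y = z $ 2;
      k = t * sin (x + y) - u * cos (x + y); \<tau> = t * cos (x + y) + u * sin (x + y) in
     \<chi> i j. if i = 1 then (if j = 1 then (p * cos x + (p * sin x + k) / cos x * sin x + \<tau>) / cos x else \<tau> / cos x)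
       else (if j = 1 then \<tau> / cos y else (r * cos y + (r * sin y + k) / cos y * sin y + \<tau>) / cos y))"

lemma matching_coeffs_nth:
  "matching_coeffs (t, u, p, r) z $ 1 = (p * sin (z $ 1) + (t * sin (z $ 1 + z $ 2) - u * cos (z $ 1 + z $ 2))) / cos (z $ 1)"
  "matching_coeffs (t, u, p, r) z $ 2 = (r * sin (z $ 2) + (t * sin (z $ 1 + z $ 2) - u * cos (z $ 1 + z $ 2))) / cos (z $ 2)"
  by (simp_all add: matching_coeffs_def Let_def axis_def)

abbreviation chart_vec :: "(real^2) set" where "chart_vec \<equiv> to_vec2 ` chart"

lemma mem_chart_vec: "z \<in> chart_vec \<longleftrightarrow> (z $ 1, z $ 2) \<in> chart"
  using to_vec2_bij(2)[of z] by (auto simp: image_iff) metis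

text \<open>
  The derivative of \<open>(p sin x + k) / cos x\<close> in \<open>x\<close> is \<open>(p cos x + k') / cos x + (p sin x + k) sin x / (cos x)\<^sup>2\<close>,
  where \<open>k' = t cos (x + y) + u sin (x + y)\<close> is the derivative of \<open>k\<close> in either variable.
\<close>

lemma has_derivative_matching_coeffs:
  assumes "z \<in> chart_vec"
  shows "(matching_coeffs q has_derivative (*v) (jacobian q z)) (at z)"
proof -
  obtain t u p r where q: "q = (t, u, p, r)" by (metis prod_cases4)
  from assms have c: "cos (z $ 1) \<noteq> 0" "cos (z $ 2) \<noteq> 0" by (auto simp: mem_chart_vec chart_def)
  have n: "((\<lambda>z :: real^2. z $ i) has_derivative (\<lambda>h. h $ i)) (at z)" for i
    by (rule bounded_linear_imp_has_derivative) (rule bounded_linear_vec_nth)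
  show ?thesis
    unfolding q matching_coeffs_def prod.case Let_def
    apply (rule has_derivative_eq_rhs)
     apply (rule derivative_eq_intros n c refl | assumption)+
    apply (rule ext)
    apply (simp add: vec_eq_iff forall_2 axis_def jacobian_def Let_def matrix_vector_mult_def sum_2)
    using c apply (simp add: field_simps power2_eq_square)
    done
qed

lemma continuous_on_jacobian: "continuous_on chart_vec (jacobian q)"
proof -
  obtain t u p r where q: "q = (t, u, p, r)" by (metis prod_cases4)
  have n: "continuous_on chart_vec (\<lambda>z. z $ i)" for i by (intro continuous_intros)
  show ?thesis
    unfolding q jacobian_def prod.case Let_def
  proof (intro continuous_on_vec_lambda)
    fix i j :: 2
    show "continuous_on chart_vec (\<lambda>z. if i = 1 then (if j = 1 then (p * cos (z $ 1) + (p * sin (z $ 1)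
      + (t * sin (z $ 1 + z $ 2) - u * cos (z $ 1 + z $ 2))) / cos (z $ 1) * sin (z $ 1) + (t * cos (z $ 1 + z $ 2) + u * sin (z $ 1 + z $ 2))) / cos (z $ 1)
      else (t * cos (z $ 1 + z $ 2) + u * sin (z $ 1 + z $ 2)) / cos (z $ 1))
      else (if j = 1 then (t * cos (z $ 1 + z $ 2) + u * sin (z $ 1 + z $ 2)) / cos (z $ 2)
        else (r * cos (z $ 2) + (r * sin (z $ 2) + (t * sin (z $ 1 + z $ 2) - u * cos (z $ 1 + z $ 2))) / cos (z $ 2) * sin (z $ 2)
          + (t * cos (z $ 1 + z $ 2) + u * sin (z $ 1 + z $ 2))) / cos (z $ 2)))"
      by (cases "i = 1"; cases "j = 1") (auto simp: mem_chart_vec chart_def intro!: continuous_intros)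
  qed
qed

lemma open_chart_vec: "open chart_vec"
proof -
  have eq: "chart_vec = {z. 0 < z $ 1} \<inter> {z. z $ 1 < 2 * pi} \<inter> {z. cos (z $ 1) \<noteq> 0} \<inter> {z. 0 < z $ 2} \<inter> {z. z $ 2 < 2 * pi} \<inter> {z. cos (z $ 2) \<noteq> 0}"
    by (rule set_eqI, unfold mem_chart_vec) (auto simp: chart_def)
  show ?thesis
    unfolding eq by (intro open_Int open_Collect_less open_Collect_neq continuous_intros)
qed

lemma open_chart: "open chart"
proof -
  have eq: "chart = {z. 0 < fst z} \<inter> {z. fst z < 2 * pi} \<inter> {z. cos (fst z) \<noteq> 0} \<inter> {z. 0 < snd z} \<inter> {z. snd z < 2 * pi} \<inter> {z. cos (snd z) \<noteq> 0}"
    by (auto simp: chart_def)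
  show ?thesis
    unfolding eq by (intro open_Int open_Collect_less open_Collect_neq continuous_intros)
qed

lemma zero_count_chart_coeffs:
  "zero_count chart (coeffs (q, w)) = emeasure (count_space UNIV) {z \<in> chart_vec. matching_coeffs q z = w}"
proof -
  obtain t u p r where q: "q = (t, u, p, r)" by (metis prod_cases4)
  let ?Z = "{z \<in> chart. gradient (coeffs (q, w)) z = 0}"
  have "gradient (coeffs (q, w)) z = 0 \<longleftrightarrow> matching_coeffs q (to_vec2 z) = w" if "z \<in> chart" for z
  proof -
    have "cos (fst z) \<noteq> 0" "cos (snd z) \<noteq> 0" using that by (auto simp: chart_def)
    then show ?thesis
      by (cases z) (auto simp: q gradient_def zero_prod_def vec_eq_iff forall_2 matching_coeffs_nth field_simps)
  qed
  then have "{z \<in> chart_vec. matching_coeffs q z = w} = to_vec2 ` ?Z" by auto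
  moreover have "inj_on to_vec2 ?Z" using to_vec2_bij(1) by (rule inj_on_subset) simp
  ultimately show ?thesis
    by (simp add: zero_count_def emeasure_count_space finite_image_iff card_image)
qed

lemma kac_rice_density_eq:
  "\<bar>det (jacobian (t, u, p, r) z)\<bar> * exp (- (norm (matching_coeffs (t, u, p, r) z))\<^sup>2 / 2) * exp (- (t\<^sup>2 + u\<^sup>2 + p\<^sup>2 + r\<^sup>2) / 2)
    = kac_rice_density (z $ 1) (z $ 2) t u p r"
proof -
  have "(norm (matching_coeffs (t, u, p, r) z))\<^sup>2 = (matching_coeffs (t, u, p, r) z $ 1)\<^sup>2 + (matching_coeffs (t, u, p, r) z $ 2)\<^sup>2"
    unfolding power2_norm_eq_inner by (simp add: inner_vec_def sum_2 power2_eq_square)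
  then have e: "exp (- (norm (matching_coeffs (t, u, p, r) z))\<^sup>2 / 2) * exp (- (t\<^sup>2 + u\<^sup>2 + p\<^sup>2 + r\<^sup>2) / 2)
    = exp (- (t\<^sup>2 + u\<^sup>2 + p\<^sup>2 + r\<^sup>2 + ((matching_coeffs (t, u, p, r) z $ 1)\<^sup>2 + (matching_coeffs (t, u, p, r) z $ 2)\<^sup>2)) / 2)"
    unfolding exp_add[symmetric] by (intro arg_cong[where f = exp]) (simp add: field_simps)
  show ?thesis
    unfolding mult.assoc e kac_rice_density_def Let_def matching_coeffs_nth
    by (simp add: det_2 jacobian_def Let_def)
qed

text \<open>
  This is the area formula for the map that sends a point to its matching coefficients.
\<close>

lemma nn_integral_zero_count_fibre:
  "(\<integral>\<^sup>+w. zero_count chart (coeffs (q, w)) * ennreal (exp (- (norm w)\<^sup>2 / 2)) \<partial>lborel)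
     = (\<integral>\<^sup>+z. ennreal (\<bar>det (jacobian q z)\<bar> * exp (- (norm (matching_coeffs q z))\<^sup>2 / 2)) * indicator chart_vec z \<partial>lborel)"
  unfolding zero_count_chart_coeffs
proof (rule area_formula[OF open_chart_vec has_derivative_matching_coeffs continuous_on_jacobian])
  show "integrable lborel (\<lambda>w :: real^2. exp (- (norm w)\<^sup>2 / 2))"
    using nn_integral_gaussian_euclidean[where 'a = "real^2"] by (intro integrableI_nonneg) auto
qed auto

lemma emeasure_chart_vec: "emeasure lborel chart_vec = ennreal (4 * pi\<^sup>2)"
proof -
  have "AE z in lborel :: (real^2) measure. z $ i \<notin> {x. cos x = 0}" for i :: 2
  proof -
    have "negligible {z :: real^2. z $ i = v}" for v
      using negligible_standard_hyperplane[of "axis i 1 :: real^2" v] by (simp add: inner_axis)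
    then have "negligible (\<Union>v\<in>{x. cos x = 0}. {z :: real^2. z $ i = v})"
      using countable_cos_zeros
      by (intro negligible_countable_Union) auto
    then have "(\<Union>v\<in>{x. cos x = 0}. {z :: real^2. z $ i = v}) \<in> null_sets lebesgue"
      by (simp only: negligible_iff_null_sets)
    from AE_not_in[OF this] show ?thesis by (simp add: AE_completion_iff)
  qed
  then have *: "AE z in lborel :: (real^2) measure. cos (z $ 1) \<noteq> 0 \<and> cos (z $ 2) \<noteq> 0"
    by (auto intro: AE_conjI)
  have "emeasure lborel chart_vec = emeasure lborel (box 0 (to_vec2 (2 * pi, 2 * pi)))"
  proof (rule emeasure_eq_AE)
    show "AE z in lborel. z \<in> chart_vec \<longleftrightarrow> z \<in> box 0 (to_vec2 (2 * pi, 2 * pi))"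
      using * by eventually_elim (unfold mem_chart_vec, auto simp: chart_def mem_box_cart forall_2)
  qed (use open_chart_vec in auto)
  also have "\<dots> = ennreal (4 * pi\<^sup>2)"
    by (subst emeasure_lborel_box_eq) (auto simp: Basis_vec_def inner_axis axis_eq_axis UNIV_2 power2_eq_square ennreal_mult)
  finally show ?thesis .
qed

lemma borel_measurable_compose_continuous:
  fixes f :: "'b::euclidean_space \<Rightarrow> ennreal" and g :: "'a::euclidean_space \<Rightarrow> 'b"
  assumes "f \<in> borel_measurable borel" "continuous_on UNIV g"
  shows "(\<lambda>x. f (g x)) \<in> borel_measurable borel"
  using measurable_compose[OF borel_measurable_continuous_onI[OF assms(2)] assms(1)] .

lemma nn_integral_lborel_Pair:
  fixes g :: "real \<times> 'b::euclidean_space \<Rightarrow> ennreal"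
  assumes g: "g \<in> borel_measurable borel"
  shows "(\<integral>\<^sup>+q. g q \<partial>lborel) = (\<integral>\<^sup>+a. \<integral>\<^sup>+b. g (a, b) \<partial>lborel \<partial>lborel)"
  using lborel.nn_integral_fst[of g lborel] g by (simp add: lborel_prod)

lemma nn_integral_lborel_4:
  fixes f :: "real \<times> real \<times> real \<times> real \<Rightarrow> ennreal"
  assumes f: "f \<in> borel_measurable borel"
  shows "(\<integral>\<^sup>+q. f q \<partial>lborel) = (\<integral>\<^sup>+t. \<integral>\<^sup>+u. \<integral>\<^sup>+p. \<integral>\<^sup>+r. f (t, u, p, r) \<partial>lborel \<partial>lborel \<partial>lborel \<partial>lborel)"
proof -
  have "(\<integral>\<^sup>+q. f q \<partial>lborel) = (\<integral>\<^sup>+t. \<integral>\<^sup>+a. f (t, a) \<partial>lborel \<partial>lborel)"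
    by (rule nn_integral_lborel_Pair[OF f])
  also have "\<dots> = (\<integral>\<^sup>+t. \<integral>\<^sup>+u. \<integral>\<^sup>+b. f (t, u, b) \<partial>lborel \<partial>lborel \<partial>lborel)"
    by (rule nn_integral_cong, rule nn_integral_lborel_Pair)
       (intro borel_measurable_compose_continuous[OF f] continuous_intros)
  also have "\<dots> = (\<integral>\<^sup>+t. \<integral>\<^sup>+u. \<integral>\<^sup>+p. \<integral>\<^sup>+r. f (t, u, p, r) \<partial>lborel \<partial>lborel \<partial>lborel \<partial>lborel)"
    by (rule nn_integral_cong, rule nn_integral_cong, rule nn_integral_lborel_Pair)
       (intro borel_measurable_compose_continuous[OF f] continuous_intros)
  finally show ?thesis .
qed

lemma borel_measurable_kac_rice_density:
  fixes g :: "'a::euclidean_space \<Rightarrow> real \<times> real \<times> real \<times> real" and z :: "'a \<Rightarrow> real^2"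
  assumes g: "continuous_on UNIV g" and z: "continuous_on UNIV z"
  shows "(\<lambda>x. case g x of (t, u, p, r) \<Rightarrow> kac_rice_density (z x $ 1) (z x $ 2) t u p r) \<in> borel_measurable borel"
proof -
  have [measurable]: "(\<lambda>x. z x $ i) \<in> borel_measurable borel" "(\<lambda>x. fst (g x)) \<in> borel_measurable borel"
    "(\<lambda>x. fst (snd (g x))) \<in> borel_measurable borel" "(\<lambda>x. fst (snd (snd (g x)))) \<in> borel_measurable borel"
    "(\<lambda>x. snd (snd (snd (g x)))) \<in> borel_measurable borel" for i
    by (intro borel_measurable_continuous_onI continuous_intros g z)+
  show ?thesis unfolding kac_rice_density_def Let_def case_prod_unfold by measurable
qed

text \<open>
  Tonelli's theorem and the area formula exchange the integral over coefficients with one over points;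
  each point contributes \<open>8 \<pi>\<^sup>2 / 3\<close>, and the area of the square is \<open>4 \<pi>\<^sup>2\<close>.
\<close>

lemma nn_integral_zero_count_gaussian:
  "(\<integral>\<^sup>+c. zero_count square c * ennreal (exp (- (norm c)\<^sup>2 / 2)) \<partial>lborel) = ennreal (32 * pi ^ 4 / 3)"
proof -
  let ?E = "\<lambda>c :: real^6. ennreal (exp (- (norm c)\<^sup>2 / 2))"
  define W where "W = (\<lambda>(t, u, p, r). t\<^sup>2 + u\<^sup>2 + p\<^sup>2 + r\<^sup>2 :: real)"
  define h where "h q z = (case q of (t, u, p, r) \<Rightarrow> kac_rice_density (z $ 1) (z $ 2) t u p r)" for q and z :: "real^2"
  have det_h: "\<bar>det (jacobian q z)\<bar> * exp (- (norm (matching_coeffs q z))\<^sup>2 / 2) = h q z * exp (W q / 2)" for q z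
  proof -
    obtain t u p r where q: "q = (t, u, p, r)" by (metis prod_cases4)
    have "exp (- (t\<^sup>2 + u\<^sup>2 + p\<^sup>2 + r\<^sup>2) / 2) * exp ((t\<^sup>2 + u\<^sup>2 + p\<^sup>2 + r\<^sup>2) / 2) = 1"
      by (simp add: add_divide_distrib diff_divide_distrib flip: exp_add)
    then show ?thesis
      unfolding q h_def W_def prod.case kac_rice_density_eq[symmetric] by (simp only: mult.assoc mult_1_right)
  qed
  have zm[measurable]: "zero_count chart \<in> borel_measurable borel"
    using borel_measurable_zero_count_gradient[of UNIV chart] open_chart by simp
  have cm[measurable]: "chart_vec \<in> sets borel" using open_chart_vec by simp
  have "(\<integral>\<^sup>+c. zero_count square c * ?E c \<partial>lborel) = (\<integral>\<^sup>+c. zero_count square c * ?E c \<partial>lebesgue)"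
    by (simp add: nn_integral_completion)
  also have "\<dots> = (\<integral>\<^sup>+c. zero_count chart c * ?E c \<partial>lebesgue)"
    using AE_zero_count_chart by (intro nn_integral_cong_AE) auto
  also have "\<dots> = (\<integral>\<^sup>+c. zero_count chart c * ?E c \<partial>distr lborel borel coeffs)"
    by (simp add: nn_integral_completion distr_coeffs)
  also have "\<dots> = (\<integral>\<^sup>+x. zero_count chart (coeffs x) * ?E (coeffs x) \<partial>(lborel \<Otimes>\<^sub>M lborel))"
    by (subst nn_integral_distr) (simp_all add: lborel_prod)
  also have "\<dots> = (\<integral>\<^sup>+q. \<integral>\<^sup>+w. zero_count chart (coeffs (q, w)) * ?E (coeffs (q, w)) \<partial>lborel \<partial>lborel)"
    by (rule lborel.nn_integral_fst[symmetric]) (simp add: lborel_prod)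
  also have "\<dots> = (\<integral>\<^sup>+q. \<integral>\<^sup>+z. ennreal (h q z) * indicator chart_vec z \<partial>lborel \<partial>lborel)"
  proof (rule nn_integral_cong)
    fix q
    have "?E (coeffs (q, w)) = ennreal (exp (- W q / 2)) * ennreal (exp (- (norm w)\<^sup>2 / 2))" for w
    proof -
      obtain t u p r where q: "q = (t, u, p, r)" by (metis prod_cases4)
      show ?thesis unfolding q norm_coeffs W_def
        by (simp add: add_divide_distrib diff_divide_distrib flip: ennreal_mult exp_add)
    qed
    then have "(\<integral>\<^sup>+w. zero_count chart (coeffs (q, w)) * ?E (coeffs (q, w)) \<partial>lborel)
      = (\<integral>\<^sup>+w. ennreal (exp (- W q / 2)) * (zero_count chart (coeffs (q, w)) * ennreal (exp (- (norm w)\<^sup>2 / 2))) \<partial>lborel)"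
      by (simp add: ac_simps)
    also have "\<dots> = ennreal (exp (- W q / 2)) * (\<integral>\<^sup>+w. zero_count chart (coeffs (q, w)) * ennreal (exp (- (norm w)\<^sup>2 / 2)) \<partial>lborel)"
    proof (rule nn_integral_cmult)
      have "(\<lambda>w. coeffs (q, w)) \<in> borel_measurable borel"
        using measurable_compose[OF _ measurable_coeffs, of "\<lambda>w. (q, w)" borel]
        by (simp add: borel_measurable_continuous_onI continuous_intros)
      then show "(\<lambda>w. zero_count chart (coeffs (q, w)) * ennreal (exp (- (norm w)\<^sup>2 / 2))) \<in> borel_measurable lborel"
        by measurable
    qed
    also have "\<dots> = (\<integral>\<^sup>+z. ennreal (exp (- W q / 2)) * (ennreal (h q z * exp (W q / 2)) * indicator chart_vec z) \<partial>lborel)"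
    proof -
      have [measurable]: "h q \<in> borel_measurable borel"
        using borel_measurable_kac_rice_density[of "\<lambda>_. q" "\<lambda>z. z"] unfolding h_def[abs_def] by (simp add: continuous_intros)
      show ?thesis
        unfolding nn_integral_zero_count_fibre det_h by (rule nn_integral_cmult[symmetric]) measurable
    qed
    also have "\<dots> = (\<integral>\<^sup>+z. ennreal (h q z) * indicator chart_vec z \<partial>lborel)"
    proof -
      have "ennreal (exp (- W q / 2)) * ennreal (h q z * exp (W q / 2)) = ennreal (h q z)" for z
      proof -
        have "exp (- W q / 2) * exp (W q / 2) = 1" by (simp flip: exp_add)
        then have "exp (- W q / 2) * (h q z * exp (W q / 2)) = h q z"
          by (simp only: mult.left_commute[of _ "h q z"] mult_1_right)
        moreover have "ennreal (exp (- W q / 2)) * ennreal (h q z * exp (W q / 2)) = ennreal (exp (- W q / 2) * (h q z * exp (W q / 2)))"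
          by (rule ennreal_mult'[symmetric]) simp
        ultimately show ?thesis by (simp only:)
      qed
      then show ?thesis by (simp flip: mult.assoc)
    qed
    finally show "(\<integral>\<^sup>+w. zero_count chart (coeffs (q, w)) * ?E (coeffs (q, w)) \<partial>lborel)
      = (\<integral>\<^sup>+z. ennreal (h q z) * indicator chart_vec z \<partial>lborel)" .
  qed
  also have "\<dots> = (\<integral>\<^sup>+z. \<integral>\<^sup>+q. ennreal (h q z) * indicator chart_vec z \<partial>lborel \<partial>lborel)"
  proof (rule lborel_pair.Fubini')
    have [measurable]: "(\<lambda>x. h (snd x) (fst x)) \<in> borel_measurable borel"
      unfolding h_def by (intro borel_measurable_kac_rice_density continuous_intros)
    have [measurable]: "(\<lambda>x. indicator chart_vec (fst x) :: ennreal) \<in> borel_measurable (borel :: ((real^2) \<times> (real \<times> real \<times> real \<times> real)) measure)"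
      by (rule borel_measurable_compose_continuous[of "indicator chart_vec" fst])
         (rule borel_measurable_indicator[OF cm], intro continuous_intros)
    show "(\<lambda>(z, q). ennreal (h q z) * indicator chart_vec z) \<in> borel_measurable (lborel \<Otimes>\<^sub>M lborel)"
      unfolding lborel_prod case_prod_unfold by measurable
  qed
  also have "\<dots> = (\<integral>\<^sup>+z. ennreal (8 * pi\<^sup>2 / 3) * indicator chart_vec z \<partial>lborel)"
  proof (rule nn_integral_cong)
    fix z :: "real^2"
    show "(\<integral>\<^sup>+q. ennreal (h q z) * indicator chart_vec z \<partial>lborel) = ennreal (8 * pi\<^sup>2 / 3) * indicator chart_vec z"
    proof (cases "z \<in> chart_vec")
      case True
      then have c: "cos (z $ 1) \<noteq> 0" "cos (z $ 2) \<noteq> 0" by (auto simp: mem_chart_vec chart_def)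
      have [measurable]: "(\<lambda>q. h q z) \<in> borel_measurable borel"
        unfolding h_def by (intro borel_measurable_kac_rice_density continuous_intros)
      have "(\<integral>\<^sup>+q. ennreal (h q z) \<partial>lborel) = (\<integral>\<^sup>+t. \<integral>\<^sup>+u. \<integral>\<^sup>+p. \<integral>\<^sup>+r. ennreal (h (t, u, p, r) z) \<partial>lborel \<partial>lborel \<partial>lborel \<partial>lborel)"
        by (rule nn_integral_lborel_4) measurable
      also have "\<dots> = ennreal (8 * pi\<^sup>2 / 3)"
        unfolding h_def prod.case using c by (rule nn_integral_kac_rice_density)
      finally show ?thesis using True by simp
    qed simp
  qed
  also have "\<dots> = ennreal (8 * pi\<^sup>2 / 3) * ennreal (4 * pi\<^sup>2)"
    using open_chart_vec by (subst nn_integral_cmult_indicator) (simp_all add: emeasure_chart_vec)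
  also have "\<dots> = ennreal (32 * pi ^ 4 / 3)"
    by (simp add: power2_eq_square power4_eq_xxxx flip: ennreal_mult)
  finally show ?thesis .
qed

theorem theorem3p6:
  fixes M :: "(int \<times> int) set"
  assumes "M = {(1, 0), (0, 1), (1, 1)}"
  shows "mean_critical_points TYPE(6) (trig_space M) = ennreal (4 * pi / 3)"
proof -
  have "mean_critical_points TYPE(6) (trig_space M) = ennreal (32 * pi ^ 4 / 3) / ennreal ((2 * pi) ^ 3)"
    unfolding assms mean_critical_points_eq_gaussian nn_integral_zero_count_gaussian ..
  also have "\<dots> = ennreal (32 * pi ^ 4 / 3 / (2 * pi) ^ 3)" by (intro divide_ennreal) auto
  also have "32 * pi ^ 4 / 3 / (2 * pi) ^ 3 = 4 * pi / 3"
    by (simp add: power_mult_distrib power3_eq_cube power4_eq_xxxx)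
  finally show ?thesis .
qed

end
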